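(* Let $D\ge4$ and $q\ge2$ be integers with $D\not\equiv0\pmod 6$. There is no non-bipartite distance-regular graph $\Gamma=(X,\mathcal{R})$ with classical parameters $(D,q,\alpha,\beta)=\left(D,q,q,\frac{q^2(q^D-1)}{q-1}\right)$ possessing a vertex $x\in X$ such that every irreducible $T(x)$-module with endpoint $1$ is thin and $\Gamma$ supports a uniform structure with respect to $x$.
   Context: All graphs are finite, simple, connected, undirected; $\partial$ denotes path-length distance. $\Gamma$ is distance-regular with diameter $D$ if for all $0\le h,i,j\le D$ and all $y,z$ with $\partial(y,z)=h$ the number $p^h_{ij}=|\{w:\partial(y,w)=i,\ \partial(z,w)=j\}|$ depends only on $h,i,j$; write $c_i=p^i_{1,i-1}$, $b_i=p^i_{1,i+1}$. $\Gamma$ has classical parameters $(D,q,\alpha,\beta)$ if $c_i=[i](1+\alpha[i-1])$ for $1\le i\le D$ and $b_i=([D]-[i])(\beta-\alpha[i])$ for $0\le i\le D-1$, where $[j]=1+q+\cdots+q^{j-1}$. Let $V=\mathbb{C}^X$ and $A$ the adjacency matrix. For fixed $x$ and $0\le i\le D$, $E_i^*$ is the diagonal matrix with $(y,y)$-entry $1$ if $\partial(x,y)=i$ and $0$ otherwise. $T=T(x)$ is the algebra generated by $A$ and $E_0^*,\dots,E_D^*$. A $T$-module is a subspace $W\subseteq V$ with $TW\subseteq W$; irreducible if $W\ne0$ with only submodules $0,W$; its endpoint is $\min\{i:E_i^*W\ne0\}$; thin if $\dim E_i^*W\le1$ for all $i$. $L=\sum_{i=1}^{D}E^*_{i-1}AE^*_i$,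 $R=\sum_{i=0}^{D-1}E^*_{i+1}AE^*_i$. $\Gamma$ supports a uniform structure with respect to $x$ if there exist a tridiagonal complex matrix $U=(e_{ij})_{1\le i,j\le D}$ with $e_{ii}=1$, such that either $e_{i,i-1}\ne0$ for all $2\le i\le D$ or $e_{i-1,i}\ne0$ for all $2\le i\le D$, and every principal submatrix $(e_{ij})_{s\le i,j\le t}$ is nonsingular, and scalars $f_1,\dots,f_D$ such that, with $e_i^-=e_{i,i-1}$ ($e_1^-=0$) and $e_i^+=e_{i,i+1}$ ($e_D^+=0$), $e_i^-RL^2+LRL+e_i^+L^2R=f_iL$ holds on $E_i^*V$ for $1\le i\le D$. *)

theory Defs
  imports "HOL-Analysis.Analysis"
begin

text \<open>
  The vertex set \<open>X\<close> of a graph is the universe of a finite type \<open>'a\<close>, and a graph is given by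
  its set \<open>G\<close> of ordered pairs of adjacent vertices.  Then \<open>\<complex>\<^sup>X\<close> is \<^typ>\<open>complex ^ 'a\<close>
  and its complex subspaces are those of the interpretation \<open>vec\<close>
  (unqualified \<open>subspace\<close> and \<open>dim\<close> would be over the reals).
\<close>

definition connected_simple_graph :: "'a::finite rel \<Rightarrow> bool" where
  "connected_simple_graph G \<longleftrightarrow> sym G \<and> irrefl G \<and> (\<forall>y z. (y, z) \<in> G\<^sup>*)"

definition bipartite_graph :: "'a::finite rel \<Rightarrow> bool" where
  "bipartite_graph G \<longleftrightarrow> (\<exists>Y. \<forall>(y, z)\<in>G. y \<in> Y \<longleftrightarrow> z \<notin> Y)"

definition gdist :: "'a::finite rel \<Rightarrow> 'a \<Rightarrow> 'a \<Rightarrow> nat" where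
  "gdist G y z = (LEAST n. (y, z) \<in> G ^^ n)"

definition gdiam :: "'a::finite rel \<Rightarrow> nat" where
  "gdiam G = Max (range (\<lambda>(y, z). gdist G y z))"

definition sphere_meet :: "'a::finite rel \<Rightarrow> nat \<Rightarrow> nat \<Rightarrow> 'a \<Rightarrow> 'a \<Rightarrow> 'a set" where
  "sphere_meet G i j y z = {w. gdist G y w = i \<and> gdist G z w = j}"

definition distance_regular :: "'a::finite rel \<Rightarrow> bool" where
  "distance_regular G \<longleftrightarrow> connected_simple_graph G \<and>
     (\<forall>h\<le>gdiam G. \<forall>i\<le>gdiam G. \<forall>j\<le>gdiam G. \<exists>p. \<forall>y z.
        gdist G y z = h \<longrightarrow> card (sphere_meet G i j y z) = p)"

definition intersection_number :: "'a::finite rel \<Rightarrow> nat \<Rightarrow> nat \<Rightarrow> nat \<Rightarrow> nat" where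
  "intersection_number G h i j =
     (THE p. \<forall>y z. gdist G y z = h \<longrightarrow> card (sphere_meet G i j y z) = p)"

definition qnum :: "real \<Rightarrow> nat \<Rightarrow> real" where
  "qnum q j = (\<Sum>k<j. q ^ k)"

definition classical_parameters :: "'a::finite rel \<Rightarrow> nat \<Rightarrow> real \<Rightarrow> real \<Rightarrow> real \<Rightarrow> bool" where
  "classical_parameters G D q \<alpha> \<beta> \<longleftrightarrow>
     gdiam G = D \<and>
     (\<forall>i\<in>{1..D}. real (intersection_number G i 1 (i - 1)) = qnum q i * (1 + \<alpha> * qnum q (i - 1))) \<and>
     (\<forall>i<D. real (intersection_number G i 1 (i + 1)) = (qnum q D - qnum q i) * (\<beta> - \<alpha> * qnum q i))"

definition adj_matrix :: "'a::finite rel \<Rightarrow> complex ^ 'a ^ 'a" where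
  "adj_matrix G = (\<chi> y z. if (y, z) \<in> G then 1 else 0)"

definition Estar :: "'a::finite rel \<Rightarrow> 'a \<Rightarrow> nat \<Rightarrow> complex ^ 'a ^ 'a" where
  "Estar G x i = (\<chi> y z. if y = z \<and> gdist G x y = i then 1 else 0)"

definition matrix_subalgebra :: "(complex ^ 'a ^ 'a::finite) set \<Rightarrow> bool" where
  "matrix_subalgebra S \<longleftrightarrow> mat 1 \<in> S \<and>
     (\<forall>M\<in>S. \<forall>N\<in>S. M + N \<in> S \<and> M ** N \<in> S) \<and>
     (\<forall>c. \<forall>M\<in>S. map_matrix ((*) c) M \<in> S)"

definition terwilliger_algebra :: "'a::finite rel \<Rightarrow> 'a \<Rightarrow> (complex ^ 'a ^ 'a) set" where
  "terwilliger_algebra G x =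
     matrix_subalgebra hull (insert (adj_matrix G) (Estar G x ` {0..gdiam G}))"

definition T_module :: "'a::finite rel \<Rightarrow> 'a \<Rightarrow> (complex ^ 'a) set \<Rightarrow> bool" where
  "T_module G x W \<longleftrightarrow> vec.subspace W \<and> (\<forall>M\<in>terwilliger_algebra G x. \<forall>w\<in>W. M *v w \<in> W)"

definition irreducible_T_module :: "'a::finite rel \<Rightarrow> 'a \<Rightarrow> (complex ^ 'a) set \<Rightarrow> bool" where
  "irreducible_T_module G x W \<longleftrightarrow> T_module G x W \<and> W \<noteq> {0} \<and>
     (\<forall>W'. T_module G x W' \<and> W' \<subseteq> W \<longrightarrow> W' = {0} \<or> W' = W)"

definition endpoint :: "'a::finite rel \<Rightarrow> 'a \<Rightarrow> (complex ^ 'a) set \<Rightarrow> nat" where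
  "endpoint G x W = (LEAST i. (*v) (Estar G x i) ` W \<noteq> {0})"

definition thin :: "'a::finite rel \<Rightarrow> 'a \<Rightarrow> (complex ^ 'a) set \<Rightarrow> bool" where
  "thin G x W \<longleftrightarrow> (\<forall>i\<le>gdiam G. vec.dim ((*v) (Estar G x i) ` W) \<le> 1)"

definition lowering :: "'a::finite rel \<Rightarrow> 'a \<Rightarrow> complex ^ 'a ^ 'a" where
  "lowering G x = (\<Sum>i=1..gdiam G. Estar G x (i - 1) ** adj_matrix G ** Estar G x i)"

definition raising :: "'a::finite rel \<Rightarrow> 'a \<Rightarrow> complex ^ 'a ^ 'a" where
  "raising G x = (\<Sum>i<gdiam G. Estar G x (i + 1) ** adj_matrix G ** Estar G x i)"

text \<open>Invertibility of the matrix with entries \<open>e i j\<close> for \<open>i, j \<in> I\<close>.\<close>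

definition nonsingular_on :: "nat set \<Rightarrow> (nat \<Rightarrow> nat \<Rightarrow> complex) \<Rightarrow> bool" where
  "nonsingular_on I e \<longleftrightarrow> (\<exists>e'. \<forall>i\<in>I. \<forall>j\<in>I.
     (\<Sum>k\<in>I. e i k * e' k j) = (if i = j then 1 else 0) \<and>
     (\<Sum>k\<in>I. e' i k * e k j) = (if i = j then 1 else 0))"

text \<open>The entries \<open>e i j\<close> matter only for \<open>1 \<le> i, j \<le> D\<close>.\<close>

definition parameter_matrix :: "nat \<Rightarrow> (nat \<Rightarrow> nat \<Rightarrow> complex) \<Rightarrow> bool" where
  "parameter_matrix D e \<longleftrightarrow>
     (\<forall>i\<in>{1..D}. \<forall>j\<in>{1..D}. i + 1 < j \<or> j + 1 < i \<longrightarrow> e i j = 0) \<and>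
     (\<forall>i\<in>{1..D}. e i i = 1) \<and>
     ((\<forall>i\<in>{2..D}. e i (i - 1) \<noteq> 0) \<or> (\<forall>i\<in>{2..D}. e (i - 1) i \<noteq> 0)) \<and>
     (\<forall>s t. 1 \<le> s \<and> s \<le> t \<and> t \<le> D \<longrightarrow> nonsingular_on {s..t} e)"

definition supports_uniform_structure :: "'a::finite rel \<Rightarrow> 'a \<Rightarrow> bool" where
  "supports_uniform_structure G x \<longleftrightarrow>
     (let D = gdiam G; L = (*v) (lowering G x); R = (*v) (raising G x) in
      \<exists>e f. parameter_matrix D e \<and>
        (\<forall>i\<in>{1..D}. \<forall>v\<in>range ((*v) (Estar G x i)).
           (if i = 1 then 0 else e i (i - 1)) *s R (L (L v)) + L (R (L v))
             + (if i = D then 0 else e i (i + 1)) *s L (L (R v))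
           = f i *s L v))"

end

theory Submission
  imports Defs "HOL-Number_Theory.Cong"
begin

text \<open>
  The parameters are those of a Grassmann graph \<open>J\<^sub>q(N, D)\<close> in which the number \<open>q ^ (N - D)\<close> is
  replaced by \<open>Q = q ^ (D + 1) - q + 1\<close>. Hence the second and third nontrivial eigenvalues of the
  adjacency matrix have multiplicities \<open>[N][N-1]/[2] - [N]\<close> and
  \<open>[N][N-1][N-2]/([2][3]) - [N][N-1]/[2]\<close>, where \<open>[N - k] = (q ^ D * Q / q ^ k - 1) / (q - 1)\<close> are
  integers. Integrality of the multiplicities forces \<open>q + 1\<close> to divide \<open>[N][N-1]\<close> and
  \<open>q\<^sup>2 + q + 1\<close> to divide \<open>[N][N-1][N-2]\<close>. For odd \<open>D\<close> the first product is \<open>-2\<close> modulo \<open>q + 1\<close>;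
  for \<open>D\<close> not divisible by 3 the second product, up to a unit, is \<open>2q + 1\<close> or \<open>-(2q + 4)\<close>
  modulo \<open>q\<^sup>2 + q + 1\<close>. Both are impossible for \<open>q \<ge> 2\<close>.

  The multiplicities come from the functions \<open>u\<close> of the distance with \<open>A M = \<theta> M\<close> for
  \<open>M = (u (\<partial>(y, z)))\<close>: a multiple of \<open>M\<close> is a symmetric idempotent, so its trace is an integer.
  These \<open>u\<close> are orthogonal polynomials in \<open>q ^ -i\<close>, with norms computed from a three-term recurrence.
\<close>

section \<open>Distance in distance-regular graphs\<close>

lemma gdist_path:
  assumes "connected_simple_graph G"
  shows "(y, z) \<in> G ^^ gdist G y z"
proof -
  have "(y, z) \<in> G\<^sup>*" using assms by (simp add: connected_simple_graph_def)
  then obtain n where "(y, z) \<in> G ^^ n" by (meson rtrancl_imp_relpow)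
  then show ?thesis unfolding gdist_def by (rule LeastI)
qed

lemma gdist_le: "(y, z) \<in> G ^^ n \<Longrightarrow> gdist G y z \<le> n"
  unfolding gdist_def by (rule Least_le)

lemma gdist_commute:
  assumes "connected_simple_graph G"
  shows "gdist G y z = gdist G z y"
proof -
  have "(z, y) \<in> G ^^ n \<longleftrightarrow> (y, z) \<in> G ^^ n" for n
  proof (induction n arbitrary: y z)
    case (Suc n)
    have "sym G" using assms by (simp add: connected_simple_graph_def)
    then show ?case
      using Suc by (metis relpow_Suc_D2 relpow_Suc_E relpow_Suc_I relpow_Suc_I2 symD)
  qed auto
  then show ?thesis by (simp add: gdist_def)
qed

lemma gdist_eq_0_iff:
  assumes "connected_simple_graph G"
  shows "gdist G y z = 0 \<longleftrightarrow> y = z"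
proof
  assume "gdist G y z = 0"
  then show "y = z" using gdist_path[OF assms, of y z] by simp
next
  assume "y = z"
  then show "gdist G y z = 0" using gdist_le[of y z 0 G] by simp
qed

lemma gdist_eq_1_iff:
  assumes "connected_simple_graph G"
  shows "gdist G y z = 1 \<longleftrightarrow> (y, z) \<in> G"
proof
  assume "gdist G y z = 1"
  then show "(y, z) \<in> G" using gdist_path[OF assms, of y z] by simp
next
  assume yz: "(y, z) \<in> G"
  then have "gdist G y z \<le> 1" using gdist_le[of y z 1 G] by simp
  moreover have "y \<noteq> z" using yz assms by (auto simp: connected_simple_graph_def irrefl_def)
  ultimately show "gdist G y z = 1"
    using gdist_eq_0_iff[OF assms, of y z] by linarith
qed

lemma gdist_edge_le:
  assumes "connected_simple_graph G" and "(z, w) \<in> G"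
  shows "gdist G y w \<le> gdist G y z + 1"
  using gdist_le[of y w "Suc (gdist G y z)" G] gdist_path[OF assms(1), of y z] assms(2)
  by (simp add: relcompI)

lemma gdist_edge_cases:
  assumes "connected_simple_graph G" and "(z, w) \<in> G"
  shows "gdist G y w = gdist G y z + 1 \<or> gdist G y w = gdist G y z \<or> gdist G y z = gdist G y w + 1"
proof -
  have "(w, z) \<in> G" using assms by (auto simp: connected_simple_graph_def dest: symD)
  then show ?thesis using gdist_edge_le[OF assms, of y] gdist_edge_le[OF assms(1), of w z y] by linarith
qed

lemma gdist_predecessor:
  assumes "connected_simple_graph G" and "gdist G y z = Suc h"
  obtains w where "(w, z) \<in> G" and "gdist G y w = h"
proof -
  have "(y, z) \<in> G ^^ Suc h" using gdist_path[OF assms(1), of y z] assms(2) by simp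
  then obtain w where w: "(y, w) \<in> G ^^ h" "(w, z) \<in> G" by auto
  then have "gdist G y w = h"
    using gdist_le[OF w(1)] gdist_edge_le[OF assms(1) w(2), of y] assms(2) by linarith
  then show thesis using that w by blast
qed

lemma gdist_le_gdiam: "gdist G y z \<le> gdiam G"
  unfolding gdiam_def by (rule Max_ge) (auto intro: range_eqI[of _ _ "(y, z)"])

section \<open>Intersection numbers and sums over neighbours\<close>

lemma card_sphere_meet:
  assumes "distance_regular G"
  shows "card (sphere_meet G i j y z) = intersection_number G (gdist G y z) i j"
proof -
  \<comment> \<open>\<open>distance_regular\<close> speaks only of indices up to the diameter;
    beyond it the sets are empty and the common value is 0.\<close>
  have "\<exists>p. \<forall>y' z'. gdist G y' z' = gdist G y z \<longrightarrow> card (sphere_meet G i j y' z') = p"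
  proof (cases "i \<le> gdiam G \<and> j \<le> gdiam G")
    case True
    then show ?thesis using assms gdist_le_gdiam[of G y z] unfolding distance_regular_def by blast
  next
    case False
    have "sphere_meet G i j y' z' = {}" for y' z'
      using False gdist_le_gdiam[of G y'] gdist_le_gdiam[of G z'] by (auto simp: sphere_meet_def)
    then show ?thesis by auto
  qed
  then obtain p where
    p: "\<forall>y' z'. gdist G y' z' = gdist G y z \<longrightarrow> card (sphere_meet G i j y' z') = p" by blast
  then have "intersection_number G (gdist G y z) i j = p"
    unfolding intersection_number_def by (intro the_equality) blast+
  then show ?thesis using p by simp
qed

text \<open>The action of the adjacency matrix on functions of the distance. With the convention
  \<open>0 - 1 = 0\<close> the value at \<open>i = 0\<close> does not depend on \<open>c 0\<close>.\<close>

definition distance_operator ::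
    "(nat \<Rightarrow> real) \<Rightarrow> (nat \<Rightarrow> real) \<Rightarrow> (nat \<Rightarrow> real) \<Rightarrow> nat \<Rightarrow> real" where
  "distance_operator b c u i = b 0 * u i + b i * (u (i + 1) - u i) + c i * (u (i - 1) - u i)"

text \<open>A neighbour of z has distance h - 1, h or h + 1 from y, where h is the distance of y and
  z. Starting from the constant u h, weighted by the degree b 0, only the two outer classes need a
  correction, and b h and c h count them.\<close>

lemma neighbour_sum:
  assumes "distance_regular G"
  shows "(\<Sum>w | (z, w) \<in> G. u (gdist G y w)) =
    distance_operator (\<lambda>i. real (intersection_number G i 1 (i + 1)))
      (\<lambda>i. real (intersection_number G i 1 (i - 1))) u (gdist G y z)"
proof -
  define h where "h = gdist G y z"
  have G: "connected_simple_graph G" using assms by (simp add: distance_regular_def)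
  \<comment> \<open>At \<open>h = 0\<close> the truncated index \<open>h - 1\<close> equals h, so
    the last correction vanishes.\<close>
  have split: "u (gdist G y w) = u h + of_bool (gdist G y w = h + 1) * (u (h + 1) - u h)
      + of_bool (gdist G y w = h - 1) * (u (h - 1) - u h)" if "(z, w) \<in> G" for w
    using gdist_edge_cases[OF G that, of y] by (auto simp: h_def)
  have cnt: "(\<Sum>w | (z, w) \<in> G. of_bool (gdist G y w = j)) = real (intersection_number G h 1 j)" for j
  proof -
    have "{w. (z, w) \<in> G \<and> gdist G y w = j} = sphere_meet G 1 j z y"
      by (auto simp: sphere_meet_def gdist_eq_1_iff[OF G, symmetric])
    then show ?thesis
      using card_sphere_meet[OF assms, of 1 j z y]
      by (simp add: h_def gdist_commute[OF G, of y] sum.If_cases of_bool_def Int_def)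
  qed
  have deg: "card {w. (z, w) \<in> G} = intersection_number G 0 1 1"
  proof -
    have "{w. (z, w) \<in> G} = sphere_meet G 1 1 z z"
      by (auto simp: sphere_meet_def gdist_eq_1_iff[OF G, symmetric])
    then show ?thesis
      using card_sphere_meet[OF assms, of 1 1 z z] gdist_eq_0_iff[OF G, of z z] by simp
  qed
  have "(\<Sum>w | (z, w) \<in> G. u (gdist G y w)) =
    (\<Sum>w | (z, w) \<in> G. u h + of_bool (gdist G y w = h + 1) * (u (h + 1) - u h)
      + of_bool (gdist G y w = h - 1) * (u (h - 1) - u h))"
    using split by (intro sum.cong) auto
  also have "\<dots> = real (intersection_number G 0 1 1) * u h
      + real (intersection_number G h 1 (h + 1)) * (u (h + 1) - u h)
      + real (intersection_number G h 1 (h - 1)) * (u (h - 1) - u h)"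
    by (simp only: sum.distrib sum_distrib_right[symmetric] cnt sum_constant deg)
  finally show ?thesis by (simp add: distance_operator_def h_def)
qed

lemma neighbour_sum_symmetric:
  fixes G :: "'a::finite rel" and f g :: "'a \<Rightarrow> real"
  assumes "sym G"
  shows "(\<Sum>z\<in>UNIV. (\<Sum>w | (z, w) \<in> G. f w) * g z) = (\<Sum>z\<in>UNIV. f z * (\<Sum>w | (z, w) \<in> G. g w))"
proof -
  have "(\<Sum>z\<in>UNIV. (\<Sum>w | (z, w) \<in> G. f w) * g z) = (\<Sum>z\<in>UNIV. \<Sum>w\<in>UNIV. if (z, w) \<in> G then f w * g z else 0)"
    by (simp add: sum_distrib_right sum.inter_filter[symmetric])
  also have "\<dots> = (\<Sum>w\<in>UNIV. \<Sum>z\<in>UNIV. if (w, z) \<in> G then f w * g z else 0)"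
    using assms by (subst sum.swap) (auto intro!: sum.cong dest: symD)
  also have "\<dots> = (\<Sum>z\<in>UNIV. f z * (\<Sum>w | (z, w) \<in> G. g w))"
    by (simp add: sum_distrib_left sum.inter_filter[symmetric])
  finally show ?thesis .
qed

section \<open>Integrality of multiplicities\<close>

text \<open>Take an orthonormal basis B of the range. P fixes each b in B, so by symmetry
  \<open>(P *v v) \<bullet> b = v \<bullet> b\<close>, and P is the sum of the projections onto the
  vectors of B. Each of these has trace 1.\<close>

lemma symmetric_idempotent_trace:
  fixes P :: "real ^ 'n ^ 'n"
  assumes sym: "transpose P = P" and idem: "P ** P = P"
  shows "trace P = real (dim (range ((*v) P)))"
proof -
  have sub: "subspace (range ((*v) P))"
    by (simp add: linear_subspace_image subspace_UNIV)
  obtain B where B: "B \<subseteq> range ((*v) P)" "pairwise orthogonal B" "\<And>b. b \<in> B \<Longrightarrow> norm b = 1"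
      "independent B" "card B = dim (range ((*v) P))" "span B = range ((*v) P)"
    using orthonormal_basis_subspace[OF sub] by blast
  have finB: "finite B" using B(4) by (rule finiteI_independent)
  have fix_B: "P *v b = b" if b: "b \<in> B" for b
  proof -
    obtain v where "b = P *v v" using subsetD[OF B(1) b] by blast
    then show ?thesis by (simp add: matrix_vector_mul_assoc idem)
  qed
  have expand: "P *v v = (\<Sum>b\<in>B. (v \<bullet> b) *\<^sub>R b)" for v
  proof -
    have "P *v v \<in> span B" using B(6) by auto
    then have "P *v v = (\<Sum>b\<in>B. ((P *v v) \<bullet> b) *\<^sub>R b)"
      using orthonormal_basis_expand[OF B(2,3)] finB by metis
    also have "\<dots> = (\<Sum>b\<in>B. (v \<bullet> (P *v b)) *\<^sub>R b)"
      using dot_lmul_matrix[of v P] sym by (metis transpose_matrix_vector)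
    finally show ?thesis using fix_B by simp
  qed
  have "trace P = (\<Sum>i\<in>UNIV. (P *v axis i 1) $ i)"
    by (simp add: trace_def matrix_vector_mul_component inner_axis)
  also have "\<dots> = (\<Sum>i\<in>UNIV. \<Sum>b\<in>B. b $ i * b $ i)"
    by (simp add: expand inner_axis' )
  also have "\<dots> = (\<Sum>b\<in>B. b \<bullet> b)"
    by (subst sum.swap) (simp add: inner_vec_def)
  also have "\<dots> = real (card B)" using B(3) by (simp add: norm_eq_1)
  finally show ?thesis using B(5) by simp
qed

text \<open>For the matrix M with entries \<open>p (gdist G y z)\<close>, the entries of the square
  of M again depend only on the distance and satisfy the recurrence of p. Hence the square is s M
  for a scalar s, M / s is a symmetric idempotent, and the expression is its trace.\<close>

lemma eigenfunction_multiplicity_integral: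
  fixes G :: "'a::finite rel" and p :: "nat \<Rightarrow> real" and x :: 'a
  defines "b \<equiv> \<lambda>i. real (intersection_number G i 1 (i + 1))"
    and "c \<equiv> \<lambda>i. real (intersection_number G i 1 (i - 1))"
  assumes G: "distance_regular G"
    and b_nz: "\<And>i. i < gdiam G \<Longrightarrow> b i \<noteq> 0"
    and eigen: "\<And>i. i \<le> gdiam G \<Longrightarrow> distance_operator b c p i = \<theta> * p i"
    and p0: "p 0 \<noteq> 0"
  shows "real CARD('a) * (p 0)\<^sup>2 / (\<Sum>z\<in>UNIV. p (gdist G x z) * p (gdist G x z)) \<in> \<int>"
proof -
  let ?d = "gdist G"
  have Gc: "connected_simple_graph G" using G by (simp add: distance_regular_def)
  \<comment> \<open>The entry of the square of M at distance h, obtained by sorting the middle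
    vertex by its two distances.\<close>
  define r where "r h = (\<Sum>i\<le>gdiam G. \<Sum>j\<le>gdiam G. real (intersection_number G h i j) * (p i * p j))"
    for h
  have r: "(\<Sum>w\<in>UNIV. p (?d y w) * p (?d z w)) = r (?d y z)" for y z
  proof -
    have "(\<Sum>w\<in>UNIV. p (?d y w) * p (?d z w)) =
        (\<Sum>w\<in>UNIV. \<Sum>i\<le>gdiam G. \<Sum>j\<le>gdiam G. of_bool (w \<in> sphere_meet G i j y z) * (p i * p j))"
    proof (intro sum.cong refl)
      fix w
      have "(\<Sum>i\<le>gdiam G. \<Sum>j\<le>gdiam G. of_bool (w \<in> sphere_meet G i j y z) * (p i * p j)) =
          (\<Sum>i\<le>gdiam G. if i = ?d y w then p i * p (?d z w) else 0)"
      proof (intro sum.cong refl)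
        fix i
        have "(\<Sum>j\<le>gdiam G. of_bool (w \<in> sphere_meet G i j y z) * (p i * p j)) =
            (\<Sum>j\<le>gdiam G. if j = ?d z w then (if i = ?d y w then p i * p j else 0) else 0)"
          by (intro sum.cong) (auto simp: sphere_meet_def)
        then show "(\<Sum>j\<le>gdiam G. of_bool (w \<in> sphere_meet G i j y z) * (p i * p j)) =
            (if i = ?d y w then p i * p (?d z w) else 0)"
          by (simp add: gdist_le_gdiam)
      qed
      then show "p (?d y w) * p (?d z w) =
          (\<Sum>i\<le>gdiam G. \<Sum>j\<le>gdiam G. of_bool (w \<in> sphere_meet G i j y z) * (p i * p j))"
        by (simp add: gdist_le_gdiam)
    qed
    also have "\<dots> = (\<Sum>i\<le>gdiam G. \<Sum>j\<le>gdiam G. \<Sum>w\<in>UNIV. of_bool (w \<in> sphere_meet G i j y z) * (p i * p j))"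
      by (subst sum.swap, intro sum.cong refl, subst sum.swap, rule refl)
    also have "\<dots> = r (?d y z)"
      unfolding r_def
      by (intro sum.cong refl)
        (simp add: sum_distrib_right[symmetric] card_sphere_meet[OF G, symmetric] of_bool_def sum.If_cases)
    finally show ?thesis .
  qed
  have nb_p: "(\<Sum>z' | (z, z') \<in> G. p (?d w z')) = \<theta> * p (?d w z)" for w z
    using neighbour_sum[OF G, where z = z and u = p and y = w] eigen[OF gdist_le_gdiam, of w z] by (simp add: b_def c_def)
  \<comment> \<open>Each row of M is an eigenvector of the adjacency matrix, so each row of its
    square is one too, for the same eigenvalue.\<close>
  have op_r: "distance_operator b c r (?d y z) = \<theta> * r (?d y z)" for y z
  proof -
    have "distance_operator b c r (?d y z) = (\<Sum>z' | (z, z') \<in> G. r (?d y z'))"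
      using neighbour_sum[OF G, where z = z and u = r and y = y] by (simp add: b_def c_def)
    also have "\<dots> = (\<Sum>w\<in>UNIV. p (?d y w) * (\<Sum>z' | (z, z') \<in> G. p (?d w z')))"
      by (simp add: r[symmetric] sum_distrib_left)
        (subst sum.swap, simp add: gdist_commute[OF Gc] mult.commute)
    also have "\<dots> = \<theta> * r (?d y z)"
      by (simp add: nb_p r[symmetric] sum_distrib_left mult_ac gdist_commute[OF Gc, of z])
    finally show ?thesis .
  qed
  define s where "s = r 0 / p 0"
  \<comment> \<open>The recurrence needs two preceding values, so both are carried through the
    induction; \<open>b h \<noteq> 0\<close> lets it be solved for the value at h + 1. The induction
    runs over pairs of vertices because \<open>op_r\<close> holds at attained distances.\<close>
  have r_p: "r h = s * p h \<and> r (h - 1) = s * p (h - 1)" if "?d y z = h" for y z h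
    using that
  proof (induction h arbitrary: y z)
    case 0
    then show ?case using p0 by (simp add: s_def)
  next
    case (Suc h)
    obtain z' where z': "(z', z) \<in> G" "?d y z' = h" using gdist_predecessor[OF Gc Suc.prems] .
    have IH: "r h = s * p h" "r (h - 1) = s * p (h - 1)" using Suc.IH[OF z'(2)] by auto
    have h: "h < gdiam G" using gdist_le_gdiam[of G y z] Suc.prems by simp
    have "b 0 * r h + b h * (r (h + 1) - r h) + c h * (r (h - 1) - r h) = \<theta> * r h"
      using op_r[of y z'] z'(2) by (simp add: distance_operator_def)
    moreover have "b 0 * p h + b h * (p (h + 1) - p h) + c h * (p (h - 1) - p h) = \<theta> * p h"
      using eigen[of h] h by (simp add: distance_operator_def)
    ultimately have "b h * r (h + 1) = b h * (s * p (h + 1))"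
      unfolding IH by algebra
    then show ?case using b_nz[OF h] IH by simp
  qed
  have s_sum: "s * p 0 = (\<Sum>z\<in>UNIV. p (?d x z) * p (?d x z))"
    using r[of x x] p0 gdist_eq_0_iff[OF Gc, of x x] by (simp add: s_def)
  have s_nz: "s \<noteq> 0"
  proof -
    have "0 < p (?d x x) * p (?d x x)"
      using p0 gdist_eq_0_iff[OF Gc, of x x] by (simp add: zero_less_mult_iff) linarith
    also have "\<dots> \<le> (\<Sum>z\<in>UNIV. p (?d x z) * p (?d x z))"
      by (rule member_le_sum) auto
    finally show ?thesis using s_sum by auto
  qed
  define P :: "real ^ 'a ^ 'a" where "P = (\<chi> y z. p (?d y z) / s)"
  have "transpose P = P"
    by (simp add: P_def transpose_def vec_eq_iff gdist_commute[OF Gc])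
  moreover have "P ** P = P"
  proof -
    have "(\<Sum>w\<in>UNIV. (p (?d y w) / s) * (p (?d w z) / s)) = p (?d y z) / s" for y z
    proof -
      have "(\<Sum>w\<in>UNIV. (p (?d y w) / s) * (p (?d w z) / s)) = (\<Sum>w\<in>UNIV. p (?d y w) * p (?d z w)) / s\<^sup>2"
        by (simp add: sum_divide_distrib power2_eq_square gdist_commute[OF Gc, of z])
      then show ?thesis using r_p[OF refl, of y z] s_nz by (simp add: r power2_eq_square)
    qed
    then show ?thesis by (simp add: P_def matrix_matrix_mult_def vec_eq_iff)
  qed
  ultimately have "trace P \<in> \<int>" by (simp add: symmetric_idempotent_trace)
  moreover have "trace P = real CARD('a) * (p 0 / s)"
  proof -
    have "?d y y = 0" for y using gdist_eq_0_iff[OF Gc] by blast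
    then show ?thesis by (simp add: trace_def P_def)
  qed
  moreover have "real CARD('a) * (p 0 / s) = real CARD('a) * (p 0)\<^sup>2 / (s * p 0)"
    using p0 by (simp add: power2_eq_square)
  ultimately show ?thesis unfolding s_sum by simp
qed

section \<open>Eigenfunctions of bidiagonal operators\<close>

definition newton_basis :: "(nat \<Rightarrow> real) \<Rightarrow> nat \<Rightarrow> nat \<Rightarrow> real" where
  "newton_basis X r i = (\<Prod>l<r. X i - X l)"

lemma newton_basis_0: "newton_basis X 0 i = 1"
  by (simp add: newton_basis_def)

lemma newton_basis_at_0: "newton_basis X (Suc r) 0 = 0"
  by (simp add: newton_basis_def prod.lessThan_Suc_shift del: prod.lessThan_Suc)

lemma times_newton_basis:
  "X i * newton_basis X r i = newton_basis X (Suc r) i + X r * newton_basis X r i"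
  by (simp add: newton_basis_def algebra_simps)

lemma distance_operator_sum:
  "distance_operator b c (\<lambda>i. \<Sum>r\<in>A. k r * u r i) i = (\<Sum>r\<in>A. k r * distance_operator b c (u r) i)"
  by (simp add: distance_operator_def sum_distrib_left sum_subtractf[symmetric] sum.distrib[symmetric]
      algebra_simps)

text \<open>The operator acts bidiagonally on the Newton basis of the nodes \<open>X\<close>, so its eigenfunctions
  \<open>eigenpoly j\<close> are polynomials of degree \<open>j\<close> in \<open>X\<close>, orthogonal for the inner product \<open>ip\<close>.\<close>

locale bidiagonal_operator =
  fixes Z :: "'z set" and d :: "'z \<Rightarrow> nat"
    and b c X \<theta> \<psi> :: "nat \<Rightarrow> real"
  assumes symmetric: "(\<Sum>z\<in>Z. distance_operator b c u (d z) * v (d z)) =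
      (\<Sum>z\<in>Z. u (d z) * distance_operator b c v (d z))"
    and psi_0: "\<psi> 0 = 0"
    and bidiagonal: "distance_operator b c (newton_basis X r) i =
      \<theta> r * newton_basis X r i + \<psi> r * newton_basis X (r - 1) i"
begin

definition ip :: "(nat \<Rightarrow> real) \<Rightarrow> (nat \<Rightarrow> real) \<Rightarrow> real" where
  "ip u v = (\<Sum>z\<in>Z. u (d z) * v (d z))"

lemma ip_sum_right: "ip u (\<lambda>i. \<Sum>r\<in>A. k r * v r i) = (\<Sum>r\<in>A. k r * ip u (v r))"
  by (simp add: ip_def sum_distrib_left) (subst sum.swap, simp add: mult_ac)

lemma ip_add_right: "ip u (\<lambda>i. k * v i + l * w i) = k * ip u v + l * ip u w"
  by (simp add: ip_def sum_distrib_left sum.distrib[symmetric] algebra_simps)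

text \<open>The solution of \<open>(\<theta> j - \<theta> r) * coef j r = \<psi> (r + 1) * coef j (r
  + 1)\<close> with leading value 1. This recurrence is the eigenvalue equation compared
  coefficientwise in the Newton basis, and it makes \<open>eigenpoly j\<close> monic.\<close>

definition coef :: "nat \<Rightarrow> nat \<Rightarrow> real" where
  "coef j r = (\<Prod>l=Suc r..j. \<psi> l / (\<theta> j - \<theta> (l - 1)))"

definition eigenpoly :: "nat \<Rightarrow> nat \<Rightarrow> real" where
  "eigenpoly j i = (\<Sum>r\<le>j. coef j r * newton_basis X r i)"

lemma coef_diag [simp]: "coef j j = 1"
  by (simp add: coef_def)

lemma coef_step:
  assumes "r < j"
  shows "coef j r = \<psi> (Suc r) / (\<theta> j - \<theta> r) * coef j (Suc r)"
proof -
  have "{Suc r..j} = insert (Suc r) {Suc (Suc r)..j}" using assms by auto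
  then show ?thesis by (simp add: coef_def)
qed

lemma eigenpoly_at_0: "eigenpoly j 0 = coef j 0"
proof -
  have "eigenpoly j 0 = (\<Sum>r\<le>j. if r = 0 then coef j 0 else 0)"
    unfolding eigenpoly_def
    by (intro sum.cong refl) (auto simp: newton_basis_0 newton_basis_at_0 gr0_conv_Suc)
  then show ?thesis by simp
qed

lemma eigenpoly_eigen:
  assumes "\<And>r. r < j \<Longrightarrow> \<theta> r \<noteq> \<theta> j"
  shows "distance_operator b c (eigenpoly j) i = \<theta> j * eigenpoly j i"
proof -
  let ?\<phi> = "\<lambda>r. newton_basis X r i"
  have "distance_operator b c (eigenpoly j) i
      = (\<Sum>r\<le>j. coef j r * \<theta> r * ?\<phi> r) + (\<Sum>r\<le>j. coef j r * \<psi> r * ?\<phi> (r - 1))"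
    unfolding eigenpoly_def[abs_def] distance_operator_sum bidiagonal
    by (simp add: sum.distrib[symmetric] algebra_simps)
  also have "(\<Sum>r\<le>j. coef j r * \<psi> r * ?\<phi> (r - 1)) = (\<Sum>r<j. coef j (Suc r) * \<psi> (Suc r) * ?\<phi> r)"
    by (subst sum.atMost_shift) (simp add: psi_0)
  also have "\<dots> = (\<Sum>r<j. coef j r * (\<theta> j - \<theta> r) * ?\<phi> r)"
  proof (intro sum.cong refl)
    fix r assume "r \<in> {..<j}"
    then have "r < j" "\<theta> j - \<theta> r \<noteq> 0" using assms[of r] by auto
    then show "coef j (Suc r) * \<psi> (Suc r) * ?\<phi> r = coef j r * (\<theta> j - \<theta> r) * ?\<phi> r"
      by (simp add: coef_step[of r j])
  qed
  also have "\<dots> = (\<Sum>r\<le>j. coef j r * (\<theta> j - \<theta> r) * ?\<phi> r)"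
    by (simp add: lessThan_Suc_atMost[symmetric])
  also have "(\<Sum>r\<le>j. coef j r * \<theta> r * ?\<phi> r) + \<dots> = \<theta> j * eigenpoly j i"
    by (simp add: eigenpoly_def sum_distrib_left sum.distrib[symmetric] algebra_simps)
  finally show ?thesis .
qed

section \<open>Orthogonality and norms of the eigenfunctions\<close>

lemma ip_eigenpoly_step:
  assumes "\<And>r. r < j \<Longrightarrow> \<theta> r \<noteq> \<theta> j"
  shows "(\<theta> j - \<theta> m) * ip (eigenpoly j) (newton_basis X m) =
    \<psi> m * ip (eigenpoly j) (newton_basis X (m - 1))"
proof -
  have "\<theta> j * ip (eigenpoly j) (newton_basis X m) =
      (\<Sum>z\<in>Z. distance_operator b c (eigenpoly j) (d z) * newton_basis X m (d z))"
    by (simp add: eigenpoly_eigen[OF assms] ip_def sum_distrib_left mult.assoc)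
  \<comment> \<open>Symmetry moves the operator onto the Newton polynomial, where it acts
    bidiagonally.\<close>
  also have "\<dots> = ip (eigenpoly j) (\<lambda>i. \<theta> m * newton_basis X m i + \<psi> m * newton_basis X (m - 1) i)"
    by (simp add: symmetric ip_def bidiagonal)
  finally show ?thesis by (simp add: ip_add_right algebra_simps)
qed

lemma ip_eigenpoly_lower:
  assumes "\<And>r. r < j \<Longrightarrow> \<theta> r \<noteq> \<theta> j" and "m < j"
  shows "ip (eigenpoly j) (newton_basis X m) = 0"
  using assms(2)
proof (induction m)
  case 0
  then show ?case using ip_eigenpoly_step[OF assms(1), of 0] assms(1)[of 0] by (simp add: psi_0)
next
  case (Suc m)
  then show ?case using ip_eigenpoly_step[OF assms(1), of "Suc m"] assms(1)[of "Suc m"] by simp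
qed

lemma ip_eigenpoly_self:
  assumes "\<And>r. r < j \<Longrightarrow> \<theta> r \<noteq> \<theta> j"
  shows "ip (eigenpoly j) (eigenpoly j) = ip (eigenpoly j) (newton_basis X j)"
proof -
  have "ip (eigenpoly j) (eigenpoly j) = (\<Sum>r\<le>j. coef j r * ip (eigenpoly j) (newton_basis X r))"
    by (subst (2) eigenpoly_def[abs_def]) (rule ip_sum_right)
  also have "\<dots> = ip (eigenpoly j) (newton_basis X j)"
    by (simp add: lessThan_Suc_atMost[symmetric] ip_eigenpoly_lower[OF assms])
  finally show ?thesis .
qed

lemma times_eigenpoly:
  "X i * eigenpoly j i = (\<Sum>r\<le>j. coef j r * newton_basis X (Suc r) i)
     + (\<Sum>r\<le>j. (coef j r * X r) * newton_basis X r i)"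
proof -
  have "X i * eigenpoly j i = (\<Sum>r\<le>j. coef j r * (X i * newton_basis X r i))"
    by (simp add: eigenpoly_def sum_distrib_left mult_ac)
  then show ?thesis
    by (simp add: times_newton_basis distrib_left sum.distrib mult.assoc)
qed

lemma ip_times_eigenpoly:
  "ip u (\<lambda>i. X i * eigenpoly j i) = (\<Sum>r\<le>j. coef j r * ip u (newton_basis X (Suc r)))
     + (\<Sum>r\<le>j. coef j r * X r * ip u (newton_basis X r))"
  unfolding times_eigenpoly
  using ip_add_right[of u 1 _ 1]
  by (simp add: ip_sum_right)

text \<open>Evaluate the inner product of \<open>eigenpoly (Suc j)\<close> with \<open>X\<close> times \<open>eigenpoly j\<close> in two ways,
  moving the factor \<open>X\<close> to the other side.\<close>

lemma eigenpoly_norm_step: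
  assumes distinct: "\<And>r s. r < s \<Longrightarrow> s \<le> j + 2 \<Longrightarrow> \<theta> r \<noteq> \<theta> s"
  shows "ip (eigenpoly (Suc j)) (eigenpoly (Suc j)) =
    \<psi> (j + 1) / (\<theta> j - \<theta> (j + 1)) *
    (\<psi> (j + 2) / (\<theta> j - \<theta> (j + 2)) - \<psi> (j + 1) / (\<theta> j - \<theta> (j + 1)) + X (j + 1) - X j
      - \<psi> j / (\<theta> (j + 1) - \<theta> (j - 1)))
    * ip (eigenpoly j) (eigenpoly j)"
proof -
  let ?K = "\<lambda>m. ip (eigenpoly j) (newton_basis X m)"
  define \<rho> where "\<rho> m = \<psi> m / (\<theta> j - \<theta> m)" for m
  have dj: "\<theta> r \<noteq> \<theta> j" if "r < j" for r using distinct[of r j] that by simp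
  have dS: "\<theta> r \<noteq> \<theta> (Suc j)" if "r < Suc j" for r using distinct[of r "Suc j"] that by simp
  have h: "ip (eigenpoly j) (eigenpoly j) = ?K j" by (rule ip_eigenpoly_self[OF dj])
  have K0: "?K m = 0" if "m < j" for m using ip_eigenpoly_lower[OF dj that] .
  \<comment> \<open>Above degree j the same one-step relation expresses the inner products through
    \<open>?K j\<close>.\<close>
  have K1: "?K (Suc j) = \<rho> (Suc j) * ?K j"
    using ip_eigenpoly_step[OF dj, of "Suc j"] distinct[of j "Suc j"] by (simp add: \<rho>_def field_simps)
  have "?K (Suc (Suc j)) = \<rho> (Suc (Suc j)) * ?K (Suc j)"
    using ip_eigenpoly_step[OF dj, of "Suc (Suc j)"] distinct[of j "Suc (Suc j)"]
    by (simp add: \<rho>_def field_simps)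
  then have K2: "?K (Suc (Suc j)) = \<rho> (Suc (Suc j)) * (\<rho> (Suc j) * ?K j)" by (simp add: K1)
  have C1: "coef (Suc j) j = - \<rho> (Suc j)"
    using coef_step[of j "Suc j"] by (simp add: \<rho>_def) (metis minus_diff_eq minus_divide_right)
  have swap: "ip u (\<lambda>i. X i * v i) = ip v (\<lambda>i. X i * u i)" for u v
    by (simp add: ip_def mult_ac)
  \<comment> \<open>X times a monic polynomial of degree j is monic of degree j + 1, and all its
    lower terms are orthogonal to \<open>eigenpoly (Suc j)\<close>.\<close>
  have "ip (eigenpoly (Suc j)) (eigenpoly (Suc j)) = ip (eigenpoly (Suc j)) (\<lambda>i. X i * eigenpoly j i)"
  proof -
    have "ip (eigenpoly (Suc j)) (newton_basis X r) = 0" if "r \<le> j" for r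
      using ip_eigenpoly_lower[OF dS, of r] that by simp
    then have "ip (eigenpoly (Suc j)) (\<lambda>i. X i * eigenpoly j i) = ip (eigenpoly (Suc j)) (newton_basis X (Suc j))"
      by (simp add: ip_times_eigenpoly lessThan_Suc_atMost[symmetric])
    then show ?thesis by (simp add: ip_eigenpoly_self[OF dS])
  qed
  also have "\<dots> = ip (eigenpoly j) (\<lambda>i. X i * eigenpoly (Suc j) i)" by (rule swap)
  also have "\<dots> = (\<Sum>r<j. coef (Suc j) r * ?K (Suc r)) + coef (Suc j) j * ?K (Suc j) + ?K (Suc (Suc j))
      + coef (Suc j) j * X j * ?K j + X (Suc j) * ?K (Suc j)"
    by (simp add: ip_times_eigenpoly lessThan_Suc_atMost[symmetric] K0)
  \<comment> \<open>Only \<open>r = j - 1\<close> survives. For \<open>j = 0\<close> the sum is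
    empty and the right side vanishes because \<open>\<psi> 0 = 0\<close>.\<close>
  also have "(\<Sum>r<j. coef (Suc j) r * ?K (Suc r)) = coef (Suc j) j * \<psi> j / (\<theta> (Suc j) - \<theta> (j - 1)) * ?K j"
  proof (cases j)
    case 0
    then show ?thesis by (simp add: psi_0)
  next
    case (Suc i)
    have "(\<Sum>r<i. coef (Suc j) r * ?K (Suc r)) = 0"
      by (intro sum.neutral) (use K0 Suc in auto)
    then have "(\<Sum>r<j. coef (Suc j) r * ?K (Suc r)) = coef (Suc j) i * ?K j"
      by (simp add: Suc)
    then show ?thesis using coef_step[of i "Suc j"] by (simp add: Suc)
  qed
  finally show ?thesis
    unfolding h K1 K2 C1 by (simp add: \<rho>_def algebra_simps)
qed

end

section \<open>Grassmann-type parameters\<close>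

text \<open>For \<open>Y = q ^ D\<close> and \<open>Q = q ^ (N - D)\<close> these are the intersection numbers of the Grassmann graph
  \<open>J\<^sub>q(N, D)\<close>; classical parameters \<open>(D, q, q, \<beta>)\<close> correspond to \<open>Q = 1 + \<beta> (q - 1) / q\<close>.\<close>

definition grass_b :: "real \<Rightarrow> real \<Rightarrow> real \<Rightarrow> nat \<Rightarrow> real" where
  "grass_b q Y Q i = q * (Y - q ^ i) * (Q - q ^ i) / (q - 1)\<^sup>2"

definition grass_c :: "real \<Rightarrow> nat \<Rightarrow> real" where
  "grass_c q i = (q ^ i - 1)\<^sup>2 / (q - 1)\<^sup>2"

definition grass_node :: "real \<Rightarrow> nat \<Rightarrow> real" where
  "grass_node q i = 1 / q ^ i"

definition grass_theta :: "real \<Rightarrow> real \<Rightarrow> real \<Rightarrow> nat \<Rightarrow> real" where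
  "grass_theta q Y Q r = (q * (Y * Q) / q ^ r - q * (Y + Q) + q ^ r + q - 1) / (q - 1)\<^sup>2"

definition grass_psi :: "real \<Rightarrow> real \<Rightarrow> real \<Rightarrow> nat \<Rightarrow> real" where
  "grass_psi q Y Q r = - (q ^ r - 1) * (1 - q * Y / q ^ r) * (1 - q * Q / q ^ r) / (q - 1)\<^sup>2"

text \<open>The nodes are geometric, so passing to a neighbouring index rescales the factors of a
  Newton polynomial and shifts them by one place. Its values at neighbouring indices therefore share
  the product \<open>P\<close> up to explicit factors, as a three-term operator requires.\<close>

lemma newton_grass_shift:
  fixes q :: real and m i :: nat
  assumes "q > 1"
  defines "\<phi> \<equiv> newton_basis (grass_node q)" and "x \<equiv> grass_node q"
    and "P \<equiv> \<lambda>i. \<Prod>l<m. grass_node q i - grass_node q (Suc l)"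
  shows "\<phi> (Suc m) i = (x i - 1) * P i"
    and "\<phi> (Suc (Suc m)) i = (x i - 1) * P i * (x i - x (Suc m))"
    and "\<phi> (Suc (Suc m)) (Suc i) = (x i / q - 1) * ((x i - 1) / q) * (P i / q ^ m)"
    and "\<phi> (Suc (Suc m)) i = q ^ (m + 2) * P (Suc i) * (x (Suc i) - x (Suc m)) * (x (Suc i) - x (Suc (Suc m)))"
proof -
  have xS: "x (Suc i) = x i / q" for i by (simp add: x_def grass_node_def)
  have x0: "x 0 = 1" by (simp add: x_def grass_node_def)
  have \<phi>: "\<phi> r i = (\<Prod>l<r. x i - x l)" for r i by (simp add: \<phi>_def x_def newton_basis_def)
  have P: "P i = (\<Prod>l<m. x i - x (Suc l))" for i by (simp add: P_def x_def)
  show 1: "\<phi> (Suc m) i = (x i - 1) * P i"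
    unfolding \<phi> P by (subst prod.lessThan_Suc_shift) (simp add: x0)
  show "\<phi> (Suc (Suc m)) i = (x i - 1) * P i * (x i - x (Suc m))"
    unfolding 1[symmetric] \<phi> by simp
  have "(\<Prod>l<m. (x i - x l / q) / q) = P i / q ^ m"
    unfolding P by (simp add: xS prod_dividef)
  then show "\<phi> (Suc (Suc m)) (Suc i) = (x i / q - 1) * ((x i - 1) / q) * (P i / q ^ m)"
    unfolding \<phi> by (simp add: prod.lessThan_Suc_shift xS x0 diff_divide_distrib[symmetric] del: prod.lessThan_Suc)
  have "x i - x l = q * (x (Suc i) - x (Suc l))" for l
    using assms(1) by (simp add: xS field_simps)
  then have "\<phi> (Suc (Suc m)) i = (\<Prod>l<Suc (Suc m). q * (x (Suc i) - x (Suc l)))" unfolding \<phi> by simp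
  then show "\<phi> (Suc (Suc m)) i = q ^ (m + 2) * P (Suc i) * (x (Suc i) - x (Suc m)) * (x (Suc i) - x (Suc (Suc m)))"
    unfolding P prod.distrib by simp
qed

text \<open>Dividing out the common product of m factors, for \<open>r = m + 2\<close>, leaves a
  rational identity in q, Y, Q, \<open>t = q ^ i\<close> and \<open>w = q ^ m\<close>. Degrees 0 and
  1 are too small for such a product and are checked directly.\<close>

lemma grass_bidiagonal:
  fixes q :: real
  assumes q: "q > 1"
  shows "distance_operator (grass_b q Y Q) (grass_c q) (newton_basis (grass_node q) r) i =
    grass_theta q Y Q r * newton_basis (grass_node q) r i
    + grass_psi q Y Q r * newton_basis (grass_node q) (r - 1) i"
proof -
  define t where "t = q ^ i"
  have t: "t > 0" "grass_node q i = 1 / t" using q by (simp_all add: t_def grass_node_def)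
  have q1: "q - 1 \<noteq> 0" "q \<noteq> 0" "t \<noteq> 0" using q t by auto
  have bc: "grass_b q Y Q i = q * (Y - t) * (Q - t) / (q - 1)\<^sup>2" "grass_c q i = (t - 1)\<^sup>2 / (q - 1)\<^sup>2"
    "grass_b q Y Q 0 = q * (Y - 1) * (Q - 1) / (q - 1)\<^sup>2"
    by (simp_all add: grass_b_def grass_c_def t_def)
  consider "r = 0" | "r = 1" | m where "r = Suc (Suc m)" by (metis One_nat_def not0_implies_Suc)
  then show ?thesis
  proof cases
    case 1
    then show ?thesis
      by (simp add: distance_operator_def newton_basis_0 grass_b_def grass_theta_def grass_psi_def algebra_simps)
  next
    case 2
    have "grass_c q i * (newton_basis (grass_node q) 1 (i - 1) - newton_basis (grass_node q) 1 i)
        = (t - 1)\<^sup>2 / (q - 1)\<^sup>2 * (q / t - 1 / t)"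
      using q1 by (cases i) (auto simp: grass_c_def newton_basis_def grass_node_def t_def)
    moreover have "newton_basis (grass_node q) 1 (i + 1) = 1 / (q * t) - 1"
      "newton_basis (grass_node q) 1 i = 1 / t - 1"
      by (simp_all add: newton_basis_def grass_node_def t_def)
    ultimately show ?thesis
      unfolding 2 distance_operator_def bc
      using q1 by (simp add: newton_basis_0 grass_theta_def grass_psi_def) (simp add: divide_simps, algebra)
  next
    case (3 m)
    define w where "w = q ^ m"
    have w: "w \<noteq> 0" using q by (simp add: w_def)
    define P where "P = (\<Prod>l<m. grass_node q i - grass_node q (Suc l))"
    note S = newton_grass_shift[OF q, where m = m]
    have n1: "newton_basis (grass_node q) (Suc m) i = (1 / t - 1) * P"
      using S(1)[of i] by (simp add: t P_def)
    have n2: "newton_basis (grass_node q) r i = (1 / t - 1) * P * (1 / t - 1 / (q * w))"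
    proof -
      have "grass_node q (Suc m) = 1 / (q * w)" by (simp add: grass_node_def w_def)
      then show ?thesis using S(2)[of i] by (simp add: t P_def 3)
    qed
    have n3: "newton_basis (grass_node q) r (i + 1) = (1 / (t * q) - 1) * ((1 / t - 1) / q) * (P / w)"
      using S(3)[of i] by (simp add: t P_def 3 w_def)
    \<comment> \<open>The factor \<open>grass_c q i\<close> stays attached: it vanishes at
      \<open>i = 0\<close>, where the index \<open>i - 1\<close> is truncated.\<close>
    have n4: "grass_c q i * newton_basis (grass_node q) r (i - 1)
        = (t - 1)\<^sup>2 / (q - 1)\<^sup>2 * (q\<^sup>2 * w * P * (1 / t - 1 / (q * w)) * (1 / t - 1 / (q\<^sup>2 * w)))"
    proof (cases i)
      case 0
      then show ?thesis by (simp add: bc t_def grass_c_def)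
    next
      case (Suc i')
      have "grass_node q (Suc m) = 1 / (q * w)" "grass_node q (Suc (Suc m)) = 1 / (q\<^sup>2 * w)"
        "q ^ (m + 2) = q\<^sup>2 * w"
        by (simp_all add: grass_node_def w_def power2_eq_square mult.assoc)
      then have "newton_basis (grass_node q) r (i - 1) =
          q\<^sup>2 * w * P * (1 / t - 1 / (q * w)) * (1 / t - 1 / (q\<^sup>2 * w))"
        using S(4)[of i'] t(2) unfolding P_def 3 Suc by simp
      then show ?thesis unfolding bc by simp
    qed
    have "distance_operator (grass_b q Y Q) (grass_c q) (newton_basis (grass_node q) r) i
      = (grass_b q Y Q 0 - grass_b q Y Q i - grass_c q i) * newton_basis (grass_node q) r i
      + grass_b q Y Q i * newton_basis (grass_node q) r (i + 1)
      + grass_c q i * newton_basis (grass_node q) r (i - 1)"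
      by (simp add: distance_operator_def algebra_simps)
    also have "\<dots> = grass_theta q Y Q r * newton_basis (grass_node q) r i
      + grass_psi q Y Q r * newton_basis (grass_node q) (Suc m) i"
    proof -
      have th: "grass_theta q Y Q r = (q * (Y * Q) / (q\<^sup>2 * w) - q * (Y + Q) + q\<^sup>2 * w + q - 1) / (q - 1)\<^sup>2"
        by (simp add: grass_theta_def 3 w_def power2_eq_square mult.assoc)
      have ps: "grass_psi q Y Q r = - (q\<^sup>2 * w - 1) * (1 - q * Y / (q\<^sup>2 * w)) * (1 - q * Q / (q\<^sup>2 * w)) / (q - 1)\<^sup>2"
        by (simp add: grass_psi_def 3 w_def power2_eq_square mult.assoc)
      show ?thesis
        unfolding n4
        unfolding n3 n2 n1 bc th ps
        using q1 w by (simp add: divide_simps) algebra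
    qed
    finally show ?thesis by (simp add: 3)
  qed
qed

section \<open>Squared norms and multiplicities\<close>

lemma grass_theta_diff:
  assumes "q > 1"
  shows "grass_theta q Y Q j - grass_theta q Y Q r =
    (q ^ j - q ^ r) * (1 - q * (Y * Q) / (q ^ j * q ^ r)) / (q - 1)\<^sup>2"
proof -
  have "q ^ j \<noteq> 0" "q ^ r \<noteq> 0" "(q - 1)\<^sup>2 \<noteq> 0" using assms by auto
  then show ?thesis unfolding grass_theta_def by (simp add: field_simps)
qed

text \<open>With \<open>w = q ^ (j + 1)\<close>, \<open>s = Y * Q / w\<^sup>2\<close> and
  \<open>e = (Y + Q) / w\<close>, the left side is w times the bracket of
  \<open>eigenpoly_norm_step\<close>. On the right, e occurs only in \<open>1 - e * q + s *
  q\<^sup>2 = (1 - q * Y / w) * (1 - q * Q / w)\<close>, a factor of \<open>grass_psi\<close> at j +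
  1.\<close>

lemma grass_norm_identity:
  fixes q w e s :: real
  assumes "q > 1" "1 - s * q \<noteq> 0" "1 - s * q\<^sup>2 \<noteq> 0" "1 - s * q ^ 3 \<noteq> 0"
  shows "(w * q - 1) * (1 - e + s) * q / ((q - 1) * (q + 1) * (1 - s * q))
      - (w - 1) * (1 - e * q + s * q\<^sup>2) * q / ((q - 1) * (1 - s * q\<^sup>2)) + 1 - q
      + (w - q) * q * (1 - e * q\<^sup>2 + s * q ^ 4) / ((q - 1) * (q + 1) * (1 - s * q ^ 3))
    = (1 - e * q + s * q\<^sup>2) * (q - 1) * (s * w * q\<^sup>2 - 1) / ((1 - s * q\<^sup>2) * (1 - s * q) * (1 - s * q ^ 3))"
proof -
  define A B C where "A = 1 - s * q" and "B = 1 - s * q\<^sup>2" and "C = 1 - s * q ^ 3"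
  define m n where "m = q - 1" and "n = q + 1"
  define U V W where "U = (w * q - 1) * (1 - e + s) * q"
    and "V = (w - 1) * (1 - e * q + s * q\<^sup>2) * q"
    and "W = (w - q) * q * (1 - e * q\<^sup>2 + s * q ^ 4)"
  define Z where "Z = (1 - e * q + s * q\<^sup>2) * m * (s * w * q\<^sup>2 - 1)"
  have nz: "A \<noteq> 0" "B \<noteq> 0" "C \<noteq> 0" "m \<noteq> 0" "n \<noteq> 0"
    using assms by (auto simp: A_def B_def C_def m_def n_def)
  have poly: "U * B * C - V * n * A * C - m * m * n * A * B * C + W * A * B = Z * m * n"
    unfolding A_def B_def C_def m_def n_def U_def V_def W_def Z_def by algebra
  have "U / (m * n * A) - V / (m * B) - m + W / (m * n * C) =
      (U * B * C - V * n * A * C - m * m * n * A * B * C + W * A * B) / (m * n * A * B * C)"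
    using nz by (simp add: field_simps)
  also have "\<dots> = Z / (B * A * C)" unfolding poly using nz by (simp add: field_simps)
  finally show ?thesis
    unfolding A_def B_def C_def m_def n_def U_def V_def W_def Z_def by simp
qed

text \<open>The argument \<open>w\<close> stands for \<open>q ^ j\<close> and \<open>S\<close> for \<open>Y * Q\<close>; this is the ratio of the squared norms
  of the monic eigenfunctions of degrees \<open>j\<close> and \<open>j - 1\<close>, divided by the square of \<open>grass_psi\<close>.\<close>

definition grass_gamma :: "real \<Rightarrow> real \<Rightarrow> real \<Rightarrow> real" where
  "grass_gamma q S w = (q - 1) ^ 4 * (q\<^sup>2 * S / w - 1) /
     (w\<^sup>2 / q * (w - 1) * (q * S / w\<^sup>2 - 1) * (q ^ 3 * S / w\<^sup>2 - 1) * (q\<^sup>2 * S / w\<^sup>2 - 1)\<^sup>2)"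

text \<open>Apart from the square of \<open>\<psi> (j + 1)\<close>, the norm ratio depends on Y and
  Q only through their product. The same \<open>\<psi>\<close> factors occur in
  \<open>coef j 0\<close>, so they cancel in the multiplicities.\<close>

lemma grass_norm_step:
  fixes q Y Q :: real
  assumes q: "q > 1" and S: "Y * Q > q ^ (2 * j + 2)"
  defines "\<psi> \<equiv> grass_psi q Y Q" and "\<theta> \<equiv> grass_theta q Y Q" and "X \<equiv> grass_node q"
  shows "\<psi> (j + 1) / (\<theta> j - \<theta> (j + 1)) *
    (\<psi> (j + 2) / (\<theta> j - \<theta> (j + 2)) - \<psi> (j + 1) / (\<theta> j - \<theta> (j + 1)) + X (j + 1) - X j
      - \<psi> j / (\<theta> (j + 1) - \<theta> (j - 1)))
    = (\<psi> (j + 1))\<^sup>2 * grass_gamma q (Y * Q) (q ^ (j + 1))"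
proof -
  define w where "w = q ^ (j + 1)"
  define s where "s = Y * Q / w\<^sup>2"
  define e where "e = (Y + Q) / w"
  define p where "p = (q - 1)\<^sup>2"
  have w: "w > 1" unfolding w_def using q by (rule one_less_power) simp
  have nz: "w \<noteq> 0" "q \<noteq> 0" "q - 1 \<noteq> 0" "p \<noteq> 0" "q + 1 \<noteq> 0" "w - 1 \<noteq> 0" using w q by (auto simp: p_def)
  \<comment> \<open>The hypothesis on \<open>Y * Q\<close> says exactly this, and it keeps the
    eigenvalue differences below from vanishing.\<close>
  have s1: "s > 1"
  proof -
    have "w\<^sup>2 = q ^ (2 * j + 2)" 
      unfolding w_def power_mult[symmetric] by (rule arg_cong[of _ _ "(^) q"]) simp
    then have "w\<^sup>2 < Y * Q" using S by simp
    then show ?thesis using w by (simp add: s_def)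
  qed
  have "s * q > 1" "s * q\<^sup>2 > 1" "s * q ^ 3 > 1"
    using s1 q by (auto intro!: less_1_mult one_less_power)
  then have snz: "1 - s * q \<noteq> 0" "1 - s * q\<^sup>2 \<noteq> 0" "1 - s * q ^ 3 \<noteq> 0" by auto
  have pw: "q ^ j = w / q" "q ^ (j + 2) = w * q" using q by (simp_all add: w_def)
  have psi: "\<psi> (j + 1) = - (w - 1) * (1 - e * q + s * q\<^sup>2) / p"
    "\<psi> (j + 2) = - (w * q - 1) * (1 - e + s) / p"
    "\<psi> j = - (w / q - 1) * (1 - e * q\<^sup>2 + s * q ^ 4) / p"
    unfolding \<psi>_def grass_psi_def pw w_def[symmetric] p_def[symmetric] e_def s_def
    using nz by (simp_all add: field_simps eval_nat_numeral)
  have th1: "\<theta> j - \<theta> (j + 1) = (w / q - w) * (1 - s * q\<^sup>2) / p"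
    unfolding \<theta>_def grass_theta_diff[OF q] pw w_def[symmetric] p_def[symmetric] s_def
    using nz by (simp add: field_simps eval_nat_numeral)
  have "\<theta> j - \<theta> (j + 2) = (w / q - w * q) * (1 - s * q) / p"
    unfolding \<theta>_def grass_theta_diff[OF q] pw w_def[symmetric] p_def[symmetric] s_def
    using nz by (simp add: field_simps eval_nat_numeral)
  moreover have "w / q - w * q = - (w * (q - 1) * (q + 1) / q)"
    using nz by (simp add: field_simps)
  ultimately have th2: "\<theta> j - \<theta> (j + 2) = - (w * (q - 1) * (q + 1) / q) * (1 - s * q) / p"
    by simp
  have r1: "\<psi> (j + 1) / (\<theta> j - \<theta> (j + 1)) = (w - 1) * (1 - e * q + s * q\<^sup>2) * q / ((q - 1) * (1 - s * q\<^sup>2)) / w"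
    unfolding psi th1 using nz snz by (simp add: divide_simps) (simp add: algebra_simps eval_nat_numeral)
  have r2: "\<psi> (j + 2) / (\<theta> j - \<theta> (j + 2)) = (w * q - 1) * (1 - e + s) * q / ((q - 1) * (q + 1) * (1 - s * q)) / w"
    unfolding psi th2 using nz snz by (simp add: divide_simps) (simp add: algebra_simps eval_nat_numeral)
  \<comment> \<open>At \<open>j = 0\<close> the left side vanishes by \<open>\<psi> 0 = 0\<close>,
    the right side because \<open>w = q\<close>.\<close>
  have r3: "\<psi> j / (\<theta> (j + 1) - \<theta> (j - 1)) =
      - ((w - q) * q * (1 - e * q\<^sup>2 + s * q ^ 4) / ((q - 1) * (q + 1) * (1 - s * q ^ 3)) / w)"
  proof (cases j)
    case 0
    then show ?thesis by (simp add: \<psi>_def grass_psi_def w_def)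
  next
    case (Suc i)
    have pi: "q ^ (j - 1) = w / q\<^sup>2" using q by (simp add: w_def Suc power2_eq_square)
    have "\<theta> (j + 1) - \<theta> (j - 1) = (w - w / q\<^sup>2) * (1 - s * q ^ 3) / p"
      unfolding \<theta>_def grass_theta_diff[OF q] pi w_def[symmetric] p_def[symmetric] s_def
      using nz by (simp add: field_simps eval_nat_numeral)
    also have "w - w / q\<^sup>2 = w * (q - 1) * (q + 1) / q\<^sup>2"
      using nz by (simp add: field_simps power2_eq_square)
    finally have th3: "\<theta> (j + 1) - \<theta> (j - 1) = w * (q - 1) * (q + 1) / q\<^sup>2 * (1 - s * q ^ 3) / p" .
    show ?thesis unfolding psi th3 using nz snz by (simp add: divide_simps) (simp add: algebra_simps eval_nat_numeral)
  qed
  have X: "X (j + 1) = 1 / w" "X j = q / w"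
    unfolding X_def grass_node_def pw w_def[symmetric] by simp_all
  have "\<psi> (j + 2) / (\<theta> j - \<theta> (j + 2)) - \<psi> (j + 1) / (\<theta> j - \<theta> (j + 1)) + X (j + 1) - X j
      - \<psi> j / (\<theta> (j + 1) - \<theta> (j - 1)) =
    (1 - e * q + s * q\<^sup>2) * (q - 1) * (s * w * q\<^sup>2 - 1) / ((1 - s * q\<^sup>2) * (1 - s * q) * (1 - s * q ^ 3)) / w"
    unfolding grass_norm_identity[OF q snz, of w e, symmetric] r1 r2 r3 X
    by (simp add: diff_divide_distrib add_divide_distrib)
  moreover have "(\<psi> (j + 1))\<^sup>2 * grass_gamma q (Y * Q) w =
      ((w - 1) * (1 - e * q + s * q\<^sup>2) * q / ((q - 1) * (1 - s * q\<^sup>2)) / w) *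
      ((1 - e * q + s * q\<^sup>2) * (q - 1) * (s * w * q\<^sup>2 - 1) / ((1 - s * q\<^sup>2) * (1 - s * q) * (1 - s * q ^ 3)) / w)"
  proof -
    have YQ: "Y * Q = s * w\<^sup>2" using nz by (simp add: s_def)
    have g: "grass_gamma q (Y * Q) w = p\<^sup>2 * (s * w * q\<^sup>2 - 1) /
        (w\<^sup>2 / q * (w - 1) * (1 - s * q) * (1 - s * q ^ 3) * (1 - s * q\<^sup>2)\<^sup>2)"
    proof -
      have "q\<^sup>2 * (s * w\<^sup>2) / w = s * w * q\<^sup>2" "q * (s * w\<^sup>2) / w\<^sup>2 = s * q"
        "q ^ 3 * (s * w\<^sup>2) / w\<^sup>2 = s * q ^ 3" "q\<^sup>2 * (s * w\<^sup>2) / w\<^sup>2 = s * q\<^sup>2"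
        using nz by (simp_all add: power2_eq_square)
      moreover have "(s * q - 1) * (s * q ^ 3 - 1) = (1 - s * q) * (1 - s * q ^ 3)" by algebra
      moreover have "(q - 1) ^ 4 = p\<^sup>2" by (simp add: p_def)
      ultimately show ?thesis
        unfolding grass_gamma_def YQ by (simp add: mult.assoc power2_commute[of 1])
    qed
    show ?thesis
      unfolding g psi using nz snz by (simp add: divide_simps) (simp add: algebra_simps eval_nat_numeral)
  qed
  ultimately show ?thesis unfolding r1 w_def[symmetric] by simp
qed

text \<open>The left sides are the multiplicities for j = 2 and j = 3, with the number of vertices
  and the \<open>grass_psi\<close> factors already cancelled; \<open>\<Delta> j r\<close> is the
  factored eigenvalue difference.\<close>

lemma grass_multiplicities:
  fixes q S :: real
  assumes q: "q > 1" and S: "S > q ^ 6"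
  defines "\<Delta> \<equiv> \<lambda>j r. (q ^ j - q ^ r) * (1 - q * S / (q ^ j * q ^ r)) / (q - 1)\<^sup>2"
  shows "1 / ((\<Delta> 2 0 * \<Delta> 2 1)\<^sup>2 * (grass_gamma q S q * grass_gamma q S (q\<^sup>2))) =
      (S - 1) * (S - q ^ 3) / (q * (q - 1) * (q\<^sup>2 - 1))"
    and "1 / ((\<Delta> 3 0 * \<Delta> 3 1 * \<Delta> 3 2)\<^sup>2 *
        (grass_gamma q S q * grass_gamma q S (q\<^sup>2) * grass_gamma q S (q ^ 3))) =
      (S - 1) * (S - q) * (S - q ^ 5) / (q ^ 3 * (q - 1) * (q\<^sup>2 - 1) * (q ^ 3 - 1))"
proof -
  define a0 a1 a2 where "a0 = S - 1" and "a1 = S / q - 1" and "a2 = S / q\<^sup>2 - 1"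
  define a3 a4 a5 where "a3 = S / q ^ 3 - 1" and "a4 = S / q ^ 4 - 1" and "a5 = S / q ^ 5 - 1"
  note a_def = a0_def a1_def a2_def a3_def a4_def a5_def
  define A where "A = q * S - 1"
  define m n l where "m = q - 1" and "n = q\<^sup>2 - 1" and "l = q ^ 3 - 1"
  have S_ne: "S \<noteq> q ^ k" if "k \<le> 6" for k
    using power_increasing[OF that less_imp_le[OF q]] S by linarith
  have a_nz: "a0 \<noteq> 0" "a1 \<noteq> 0" "a2 \<noteq> 0" "a3 \<noteq> 0" "a4 \<noteq> 0" "a5 \<noteq> 0"
    using S_ne[of 0] S_ne[of 1] S_ne[of 2] S_ne[of 3] S_ne[of 4] S_ne[of 5] q
    by (simp_all add: a_def)
  have nz: "q \<noteq> 0" "m \<noteq> 0" "n \<noteq> 0" "l \<noteq> 0"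
  proof -
    have "1 < q\<^sup>2" "1 < q ^ 3" using q by (simp_all add: one_less_power)
    then show "q \<noteq> 0" "m \<noteq> 0" "n \<noteq> 0" "l \<noteq> 0" using q unfolding m_def n_def l_def by linarith+
  qed
  have "1 \<le> q ^ 6" using q by (simp add: one_le_power)
  then have "1 < S" using S by linarith
  then have "1 < q * S" using q by (simp add: less_1_mult)
  then have A_nz: "A \<noteq> 0" by (simp add: A_def)
  have \<Delta>: "\<Delta> 2 0 = - n * a1 / m\<^sup>2" "\<Delta> 2 1 = - (q * m) * a2 / m\<^sup>2"
    "\<Delta> 3 0 = - l * a2 / m\<^sup>2" "\<Delta> 3 1 = - (q * n) * a3 / m\<^sup>2" "\<Delta> 3 2 = - (q\<^sup>2 * m) * a4 / m\<^sup>2"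
    unfolding \<Delta>_def a_def m_def[symmetric] n_def l_def
    using nz by (simp_all add: m_def field_simps eval_nat_numeral)
  \<comment> \<open>For \<open>w = q\<close> the numerator and one factor of the denominator are
    both A.\<close>
  have g1: "grass_gamma q S q = m ^ 4 * A / (q * m * a1 * A * a0\<^sup>2)"
    unfolding grass_gamma_def A_def a_def m_def using nz by (simp add: eval_nat_numeral)
  have g2: "grass_gamma q S (q\<^sup>2) = m ^ 4 * a0 / (q ^ 3 * n * a3 * a1 * a2\<^sup>2)"
    unfolding grass_gamma_def a_def m_def n_def using nz by (simp add: eval_nat_numeral)
  have g3: "grass_gamma q S (q ^ 3) = m ^ 4 * a1 / (q ^ 5 * l * a5 * a3 * a4\<^sup>2)"
    unfolding grass_gamma_def a_def m_def l_def using nz by (simp add: eval_nat_numeral)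
  have "1 / ((\<Delta> 2 0 * \<Delta> 2 1)\<^sup>2 * (grass_gamma q S q * grass_gamma q S (q\<^sup>2))) =
      q\<^sup>2 * a0 * a3 / (m * n)"
    unfolding \<Delta> g1 g2 
    using nz A_nz a_nz by (simp add: divide_simps power_mult_distrib) (simp add: eval_nat_numeral)
  also have "\<dots> = (S - 1) * (S - q ^ 3) / (q * m * n)"
    using nz by (simp add: a_def field_simps eval_nat_numeral)
  finally show "1 / ((\<Delta> 2 0 * \<Delta> 2 1)\<^sup>2 * (grass_gamma q S q * grass_gamma q S (q\<^sup>2))) =
      (S - 1) * (S - q ^ 3) / (q * (q - 1) * (q\<^sup>2 - 1))"
    by (simp add: m_def n_def)
  have "1 / ((\<Delta> 3 0 * \<Delta> 3 1 * \<Delta> 3 2)\<^sup>2 *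
        (grass_gamma q S q * grass_gamma q S (q\<^sup>2) * grass_gamma q S (q ^ 3))) =
      q ^ 3 * a0 * a1 * a5 / (m * n * l)"
    unfolding \<Delta> g1 g2 g3 
    using nz A_nz a_nz by (simp add: divide_simps power_mult_distrib) (simp add: eval_nat_numeral)
  also have "\<dots> = (S - 1) * (S - q) * (S - q ^ 5) / (q ^ 3 * m * n * l)"
    using nz by (simp add: a_def field_simps eval_nat_numeral)
  finally show "1 / ((\<Delta> 3 0 * \<Delta> 3 1 * \<Delta> 3 2)\<^sup>2 *
        (grass_gamma q S q * grass_gamma q S (q\<^sup>2) * grass_gamma q S (q ^ 3))) =
      (S - 1) * (S - q) * (S - q ^ 5) / (q ^ 3 * (q - 1) * (q\<^sup>2 - 1) * (q ^ 3 - 1))"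
    by (simp add: m_def n_def l_def)
qed

text \<open>Squared norms telescope down to the constant function 1, whose squared norm is the
  number of vertices. Combined with the values at 0 they give the traces of idempotents.\<close>

lemma grass_multiplicities_integral:
  fixes G :: "'a::finite rel" and q Y Q :: real
  assumes G: "distance_regular G" and q: "q > 1" and Y: "Y > q ^ 3" and Q: "Q > q ^ 3"
    and b: "\<And>i. i \<le> gdiam G \<Longrightarrow> real (intersection_number G i 1 (i + 1)) = grass_b q Y Q i"
    and c: "\<And>i. i \<le> gdiam G \<Longrightarrow> real (intersection_number G i 1 (i - 1)) = grass_c q i"
    and b_nz: "\<And>i. i < gdiam G \<Longrightarrow> grass_b q Y Q i \<noteq> 0"
  defines "S \<equiv> Y * Q"
  shows "(S - 1) * (S - q ^ 3) / (q * (q - 1) * (q\<^sup>2 - 1)) \<in> \<int>"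
    and "(S - 1) * (S - q) * (S - q ^ 5) / (q ^ 3 * (q - 1) * (q\<^sup>2 - 1) * (q ^ 3 - 1)) \<in> \<int>"
proof -
  fix x :: 'a
  let ?b = "grass_b q Y Q" and ?c = "grass_c q"
  have Gc: "connected_simple_graph G" using G by (simp add: distance_regular_def)
  then have "sym G" by (simp add: connected_simple_graph_def)
  have op: "distance_operator (\<lambda>i. real (intersection_number G i 1 (i + 1)))
      (\<lambda>i. real (intersection_number G i 1 (i - 1))) u i = distance_operator ?b ?c u i"
    if "i \<le> gdiam G" for u i
    using that b[of i] b[of 0] c[of i] by (simp add: distance_operator_def)
  have nb: "distance_operator ?b ?c u (gdist G x z) = (\<Sum>w | (z, w) \<in> G. u (gdist G x w))" for u z
    by (simp only: neighbour_sum[OF G] op[OF gdist_le_gdiam])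
  interpret bidiagonal_operator UNIV "gdist G x" ?b ?c "grass_node q" "grass_theta q Y Q" "grass_psi q Y Q"
  proof
    show "(\<Sum>z\<in>UNIV. distance_operator ?b ?c u (gdist G x z) * v (gdist G x z)) =
        (\<Sum>z\<in>UNIV. u (gdist G x z) * distance_operator ?b ?c v (gdist G x z))" for u v
      unfolding nb by (rule neighbour_sum_symmetric[OF \<open>sym G\<close>])
    show "grass_psi q Y Q 0 = 0" by (simp add: grass_psi_def)
  qed (rule grass_bidiagonal[OF q])
  let ?\<theta> = "grass_theta q Y Q" and ?\<psi> = "grass_psi q Y Q" and ?\<gamma> = "grass_gamma q S"
  have S6: "S > q ^ 6"
  proof -
    have "q ^ 6 = q ^ 3 * q ^ 3" by (simp add: power_add[symmetric])
    also have "\<dots> < Y * Q"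
      using Y Q q by (intro mult_strict_mono) (auto intro: order.strict_trans[of 0 "q ^ 3" Y])
    finally show ?thesis by (simp add: S_def)
  qed
  \<comment> \<open>The norm step at \<open>j = 2\<close> involves \<open>?\<theta> 4\<close>.
    Indices r < s \<le> 4 add up to at most 7, and \<open>q ^ 7 < q * S\<close>.\<close>
  have distinct: "?\<theta> r \<noteq> ?\<theta> s" if "r < s" "s \<le> 4" for r s
  proof -
    have "q ^ s * q ^ r \<le> q ^ 7"
      unfolding power_add[symmetric] using that q by (intro power_increasing) auto
    also have "q ^ 7 = q * q ^ 6" by (simp add: power_Suc[symmetric])
    also have "\<dots> < q * S" using S6 q by simp
    finally have "1 - q * S / (q ^ s * q ^ r) \<noteq> 0" using q by (simp add: field_simps)
    moreover have "q ^ r < q ^ s" using that q by (intro power_strict_increasing) auto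
    ultimately have "?\<theta> s - ?\<theta> r \<noteq> 0"
      unfolding grass_theta_diff[OF q] using q by (simp add: S_def)
    then show ?thesis by simp
  qed
  \<comment> \<open>This makes the eigenfunctions nonzero at 0 and permits the cancellation of the
    \<open>?\<psi>\<close> factors.\<close>
  have psi_nz: "?\<psi> l \<noteq> 0" if "0 < l" "l \<le> 3" for l
  proof -
    have "q ^ l \<le> q ^ 3" using that q by (intro power_increasing) auto
    moreover have "0 < q ^ 3" using q by simp
    then have "Y > 0" "Q > 0" using Y Q by linarith+
    then have "Y < q * Y" "Q < q * Q" using q by simp_all
    ultimately have "q ^ l < q * Y" "q ^ l < q * Q" using Y Q by auto
    moreover have "q ^ l > 1" using q that by (intro one_less_power) auto
    ultimately have "q ^ l - 1 \<noteq> 0" "1 - q * Y / q ^ l \<noteq> 0" "1 - q * Q / q ^ l \<noteq> 0"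
      using q by (simp_all add: field_simps)
    then show ?thesis using q by (simp add: grass_psi_def)
  qed
  have h0: "ip (eigenpoly 0) (eigenpoly 0) = real CARD('a)"
    by (simp add: ip_def eigenpoly_def newton_basis_0)
  have h: "ip (eigenpoly (Suc j)) (eigenpoly (Suc j)) =
      (?\<psi> (j + 1))\<^sup>2 * ?\<gamma> (q ^ (j + 1)) * ip (eigenpoly j) (eigenpoly j)" if "j \<le> 2" for j
  proof -
    have "q ^ (2 * j + 2) \<le> q ^ 6" using that q by (intro power_increasing) auto
    then have "q ^ (2 * j + 2) < Y * Q" using S6 by (simp add: S_def)
    then show ?thesis
      unfolding S_def grass_norm_step[OF q \<open>q ^ (2 * j + 2) < Y * Q\<close>, symmetric]
      by (intro eigenpoly_norm_step distinct) (use that in auto)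
  qed
  have int: "real CARD('a) * (coef j 0)\<^sup>2 / ip (eigenpoly j) (eigenpoly j) \<in> \<int>" if "j \<le> 3" for j
  proof -
    have "?\<psi> l / (?\<theta> j - ?\<theta> (l - 1)) \<noteq> 0" if "l \<in> {Suc 0..j}" for l
    proof -
      have "l - 1 < j" "0 < l" "l \<le> 3" using that \<open>j \<le> 3\<close> by auto
      then show ?thesis using psi_nz[of l] distinct[of "l - 1" j] \<open>j \<le> 3\<close> by simp
    qed
    then have p0: "eigenpoly j 0 \<noteq> 0" unfolding eigenpoly_at_0 coef_def by simp
    have "?\<theta> r \<noteq> ?\<theta> j" if "r < j" for r using distinct[of r j] that \<open>j \<le> 3\<close> by simp
    then have "distance_operator ?b ?c (eigenpoly j) i = ?\<theta> j * eigenpoly j i" for i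
      by (rule eigenpoly_eigen)
    then have "real CARD('a) * (eigenpoly j 0)\<^sup>2 /
        (\<Sum>z\<in>UNIV. eigenpoly j (gdist G x z) * eigenpoly j (gdist G x z)) \<in> \<int>"
      by (intro eigenfunction_multiplicity_integral[OF G, where \<theta> = "?\<theta> j"] p0)
        (simp_all only: op b[OF less_imp_le] b_nz not_False_eq_True)
    then show ?thesis by (simp only: eigenpoly_at_0 ip_def)
  qed
  define \<Delta> where "\<Delta> j r = (q ^ j - q ^ r) * (1 - q * S / (q ^ j * q ^ r)) / (q - 1)\<^sup>2" for j r
  have th: "?\<theta> j - ?\<theta> r = \<Delta> j r" for j r by (simp only: \<Delta>_def S_def grass_theta_diff[OF q])
  have "coef 2 0 = ?\<psi> 1 * ?\<psi> 2 / (\<Delta> 2 0 * \<Delta> 2 1)"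
    by (simp add: coef_def eval_nat_numeral th)
  moreover have "ip (eigenpoly 2) (eigenpoly 2) =
      (?\<psi> 1 * ?\<psi> 2)\<^sup>2 * (?\<gamma> q * ?\<gamma> (q\<^sup>2)) * real CARD('a)"
    using h[of 0] h[of 1] h0 by (simp add: eval_nat_numeral mult_ac)
  ultimately have "real CARD('a) * (coef 2 0)\<^sup>2 / ip (eigenpoly 2) (eigenpoly 2) =
      1 / ((\<Delta> 2 0 * \<Delta> 2 1)\<^sup>2 * (?\<gamma> q * ?\<gamma> (q\<^sup>2)))"
    using psi_nz[of 1] psi_nz[of 2] by (simp add: power_divide power_mult_distrib)
  then show "(S - 1) * (S - q ^ 3) / (q * (q - 1) * (q\<^sup>2 - 1)) \<in> \<int>"
    using int[of 2] grass_multiplicities(1)[OF q S6] by (simp add: \<Delta>_def)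
  have "coef 3 0 = ?\<psi> 1 * ?\<psi> 2 * ?\<psi> 3 / (\<Delta> 3 0 * \<Delta> 3 1 * \<Delta> 3 2)"
    by (simp add: coef_def eval_nat_numeral th)
  moreover have "ip (eigenpoly 3) (eigenpoly 3) =
      (?\<psi> 1 * ?\<psi> 2 * ?\<psi> 3)\<^sup>2 * (?\<gamma> q * ?\<gamma> (q\<^sup>2) * ?\<gamma> (q ^ 3)) * real CARD('a)"
    using h[of 0] h[of 1] h[of 2] h0 by (simp add: eval_nat_numeral mult_ac)
  ultimately have "real CARD('a) * (coef 3 0)\<^sup>2 / ip (eigenpoly 3) (eigenpoly 3) =
      1 / ((\<Delta> 3 0 * \<Delta> 3 1 * \<Delta> 3 2)\<^sup>2 * (?\<gamma> q * ?\<gamma> (q\<^sup>2) * ?\<gamma> (q ^ 3)))"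
    using psi_nz[of 1] psi_nz[of 2] psi_nz[of 3] by (simp add: power_divide power_mult_distrib)
  then show "(S - 1) * (S - q) * (S - q ^ 5) / (q ^ 3 * (q - 1) * (q\<^sup>2 - 1) * (q ^ 3 - 1)) \<in> \<int>"
    using int[of 3] grass_multiplicities(2)[OF q S6] by (simp add: \<Delta>_def)
qed

section \<open>Divisibility\<close>

lemma qnum_eq: "q \<noteq> 1 \<Longrightarrow> qnum q j = (q ^ j - 1) / (q - 1)"
  by (simp add: qnum_def sum_gp_strict divide_simps) (simp add: algebra_simps)

text \<open>From \<open>q ^ d - 1 = (q - 1) * n\<close>, the power \<open>q ^ d\<close> is 1 modulo
  n, and a geometric sum of length \<open>d * m\<close> splits into m blocks that are multiples of
  n.\<close>

lemma geometric_sum_cong: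
  fixes q :: int and d m :: nat
  defines "n \<equiv> \<Sum>k<d. q ^ k"
  shows "[(\<Sum>k<d * m. q ^ k) = 0] (mod n)" and "[q ^ (d * m) = 1] (mod n)"
proof -
  show *: "[q ^ (d * m) = 1] (mod n)" for m
  proof (induction m)
    case (Suc m)
    have "q ^ d - 1 = (q - 1) * n" by (simp add: n_def power_diff_1_eq)
    then have "[q ^ d = 1] (mod n)" by (simp add: cong_iff_dvd_diff)
    then have "[q ^ d * q ^ (d * m) = 1 * 1] (mod n)" using Suc by (intro cong_mult)
    then show ?case by (simp add: power_add)
  qed simp
  show "[(\<Sum>k<d * m. q ^ k) = 0] (mod n)"
  proof (induction m)
    case (Suc m)
    have "(\<Sum>k<a + b. q ^ k) = (\<Sum>k<a. q ^ k) + q ^ a * (\<Sum>k<b. q ^ k)" for a b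
      by (induction b) (simp_all add: power_add algebra_simps)
    from this[of "d * m" d] have "(\<Sum>k<d * Suc m. q ^ k) = (\<Sum>k<d * m. q ^ k) + q ^ (d * m) * n"
      by (simp add: n_def add.commute)
    moreover have "[(\<Sum>k<d * m. q ^ k) + q ^ (d * m) * n = 0 + 0] (mod n)"
      using Suc by (intro cong_add) (simp_all add: cong_0_iff)
    ultimately show ?case by simp
  qed simp
qed

lemma grassmann_divisibility:
  fixes q :: int and D :: nat
  assumes q: "q \<ge> 2"
  defines "N \<equiv> (\<Sum>k<D. q ^ k) * (1 + q ^ (D + 1))"
  assumes two: "q + 1 dvd N * (N - 1)"
    and three: "q\<^sup>2 + q + 1 dvd N * (N - 1) * (N - 1 - q)"
  shows "D mod 6 = 0"
proof -
  have step: "(\<Sum>k<Suc n. q ^ k) = 1 + q * (\<Sum>k<n. q ^ k)" for n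
    by (simp add: sum.lessThan_Suc_shift sum_distrib_left del: sum.lessThan_Suc)
  have "D mod 2 = 0"
  proof (rule ccontr)
    assume "D mod 2 \<noteq> 0"
    then obtain m where D: "D = Suc (2 * m)" by (metis oddE Suc_eq_plus1 even_iff_mod_2_eq_zero)
    have n: "(\<Sum>k<2. q ^ k) = q + 1" by (simp add: eval_nat_numeral)
    \<comment> \<open>Modulo q + 1 the square of q is 1, so a sum of odd length reduces to its first
      term and \<open>q ^ (D + 1)\<close>, with even exponent, to 1.\<close>
    note g = geometric_sum_cong[of q 2 m, unfolded n]
    have "[(\<Sum>k<D. q ^ k) = 1 + q * 0] (mod (q + 1))"
      unfolding D step by (intro cong_add cong_mult g cong_refl)
    moreover have "[q ^ (D + 1) = 1] (mod (q + 1))"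
      using geometric_sum_cong(2)[of q 2 "Suc m", unfolded n] by (simp add: D)
    ultimately have "[N = (1 + q * 0) * (1 + 1)] (mod (q + 1))"
      unfolding N_def by (intro cong_mult cong_add cong_refl)
    then have N: "[N = 2] (mod (q + 1))" by simp
    then have "[N * (N - 1) = 2 * (2 - 1)] (mod (q + 1))" by (intro cong_mult cong_diff cong_refl)
    then have "q + 1 dvd 2" using two by (simp add: cong_dvd_iff cong_def dvd_eq_mod_eq_0)
    then show False using q zdvd_imp_le[of "q + 1" 2] by simp
  qed
  moreover have "D mod 3 = 0"
  proof (rule ccontr)
    assume "D mod 3 \<noteq> 0"
    define m where "m = D div 3"
    define n where "n = q\<^sup>2 + q + 1"
    have n: "(\<Sum>k<3. q ^ k) = n" by (simp add: eval_nat_numeral n_def)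
    note g = geometric_sum_cong[of q 3 m, unfolded n]
    have reduce: "[t = s] (mod n)" if "t - s = n * k" for t s k :: int
      using that by (simp add: cong_iff_dvd_diff)
    have mod_n: "n dvd s" if "[N * (N - 1) * (N - 1 - q) = s] (mod n)" for s
      using that three by (simp add: n_def cong_dvd_iff cong_def dvd_eq_mod_eq_0)
    have "D = Suc (3 * m) \<or> D = Suc (Suc (3 * m))"
      using \<open>D mod 3 \<noteq> 0\<close> unfolding m_def by presburger
    then show False
    proof
      assume D: "D = Suc (3 * m)"
      have "[(\<Sum>k<D. q ^ k) = 1 + q * 0] (mod n)"
        unfolding D step by (intro cong_add cong_mult g cong_refl)
      moreover have "[q ^ (D + 1) = q\<^sup>2 * 1] (mod n)"
      proof -
        have "q ^ (D + 1) = q\<^sup>2 * q ^ (3 * m)" by (simp add: D power2_eq_square)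
        then show ?thesis using g(2) by (metis cong_refl cong_mult)
      qed
      ultimately have "[N = (1 + q * 0) * (1 + q\<^sup>2 * 1)] (mod n)"
        unfolding N_def by (intro cong_mult cong_add cong_refl)
      also have "[(1 + q * 0) * (1 + q\<^sup>2 * 1) = - q] (mod n)"
        by (rule reduce[of _ _ 1]) (simp add: n_def)
      finally have "[N * (N - 1) * (N - 1 - q) = - q * (- q - 1) * (- q - 1 - q)] (mod n)"
        by (intro cong_mult cong_diff cong_refl)
      \<comment> \<open>Since \<open>q * (q + 1) = n - 1\<close>, the product is
        \<open>(n - 1) * (- 2 * q - 1)\<close>; this yields the cofactor.\<close>
      also have "[- q * (- q - 1) * (- q - 1 - q) = 2 * q + 1] (mod n)"
        by (rule reduce[of _ _ "- 2 * q - 1"]) (simp add: n_def algebra_simps power2_eq_square)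
      finally have "n dvd 2 * q + 1" by (rule mod_n)
      then have "n \<le> 2 * q + 1" using q by (intro zdvd_imp_le) auto
      moreover have "q\<^sup>2 \<ge> 2 * q" using q by (simp add: power2_eq_square)
      ultimately show False using q by (simp add: n_def)
    next
      assume D: "D = Suc (Suc (3 * m))"
      have "[(\<Sum>k<D. q ^ k) = 1 + q * (1 + q * 0)] (mod n)"
        unfolding D step by (intro cong_add cong_mult g cong_refl)
      moreover have "[q ^ (D + 1) = 1] (mod n)"
        using geometric_sum_cong(2)[of q 3 "Suc m", unfolded n] by (simp add: D eval_nat_numeral)
      ultimately have "[N = (1 + q * (1 + q * 0)) * (1 + 1)] (mod n)"
        unfolding N_def by (intro cong_mult cong_add cong_refl)
      then have "[N = 2 * (1 + q)] (mod n)" by (simp add: mult.commute)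
      then have "[N * (N - 1) * (N - 1 - q) = 2 * (1 + q) * (2 * (1 + q) - 1) * (2 * (1 + q) - 1 - q)] (mod n)"
        by (intro cong_mult cong_diff cong_refl)
      \<comment> \<open>The cofactor comes from \<open>(1 + q)\<^sup>2 = n + q\<close> and
        \<open>2 * q * (2 * q + 1) = 4 * n - (2 * q + 4)\<close>.\<close>
      also have "[2 * (1 + q) * (2 * (1 + q) - 1) * (2 * (1 + q) - 1 - q) = - (2 * q + 4)] (mod n)"
        by (rule reduce[of _ _ "4 * q + 6"]) (simp add: n_def algebra_simps power2_eq_square)
      finally have "n dvd 2 * q + 4" using mod_n by (metis dvd_minus_iff)
      then have "n \<le> 2 * q + 4" using q by (intro zdvd_imp_le) auto
      \<comment> \<open>For q \<ge> 3, n is at least \<open>4 * q + 1\<close> and exceeds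
        \<open>2 * q + 4\<close>; for q = 2, 7 does not divide 8.\<close>
      moreover have "q = 2 \<or> q\<^sup>2 \<ge> 3 * q" using q by (auto simp: power2_eq_square)
      ultimately have "q = 2" using q by (auto simp: n_def)
      then show False using \<open>n dvd 2 * q + 4\<close> by (simp add: n_def)
    qed
  qed
  ultimately show ?thesis by presburger
qed

section \<open>From integral multiplicities to the contradiction\<close>

lemma of_int_divide_in_Ints_iff:
  fixes a b :: int
  assumes "b \<noteq> 0"
  shows "(of_int a / of_int b :: real) \<in> \<int> \<longleftrightarrow> b dvd a"
proof
  assume "(of_int a / of_int b :: real) \<in> \<int>"
  then obtain k where "of_int a / of_int b = (of_int k :: real)" by (auto elim: Ints_cases)
  then have "real_of_int a = of_int (k * b)" using assms by (simp add: field_simps)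
  then show "b dvd a" by (simp only: of_int_eq_iff) simp
qed (use assms in auto)

theorem theorem8p2:
  fixes D :: nat and q :: int
  assumes "D \<ge> 4" and "q \<ge> 2" and "D mod 6 \<noteq> 0"
  shows "\<nexists>G :: 'a::finite rel.
    distance_regular G \<and> \<not> bipartite_graph G \<and>
    classical_parameters G D (of_int q) (of_int q)
      ((of_int q)\<^sup>2 * ((of_int q) ^ D - 1) / (of_int q - 1)) \<and>
    (\<exists>x. (\<forall>W. irreducible_T_module G x W \<and> endpoint G x W = 1 \<longrightarrow> thin G x W) \<and>
         supports_uniform_structure G x)"
proof
  assume "\<exists>G :: 'a::finite rel.
    distance_regular G \<and> \<not> bipartite_graph G \<and>
    classical_parameters G D (of_int q) (of_int q)
      ((of_int q)\<^sup>2 * ((of_int q) ^ D - 1) / (of_int q - 1)) \<and>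
    (\<exists>x. (\<forall>W. irreducible_T_module G x W \<and> endpoint G x W = 1 \<longrightarrow> thin G x W) \<and>
         supports_uniform_structure G x)"
  then obtain G :: "'a rel" where G: "distance_regular G"
    and cp: "classical_parameters G D (of_int q) (of_int q)
      ((of_int q)\<^sup>2 * ((of_int q) ^ D - 1) / (of_int q - 1))" by blast
  define r where "r = real_of_int q"
  define Y where "Y = r ^ D"
  \<comment> \<open>This is \<open>1 + \<beta> * (r - 1) / r\<close> for the given value of
    \<beta>.\<close>
  define Q where "Q = r * Y - r + 1"
  have r: "r > 1" using assms(2) by (simp add: r_def)
  have diam: "gdiam G = D" using cp by (simp add: classical_parameters_def)
  have Gc: "connected_simple_graph G" using G by (simp add: distance_regular_def)
  have "r ^ 3 < Y" unfolding Y_def using assms(1) r by (intro power_strict_increasing) auto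
  moreover have "Y \<le> Q"
  proof -
    have "Y \<ge> 1" unfolding Y_def using r by (intro one_le_power) simp
    then have "0 \<le> (r - 1) * (Y - 1)" using r by simp
    then show ?thesis by (simp add: Q_def algebra_simps)
  qed
  ultimately have YQ: "r ^ 3 < Y" "r ^ 3 < Q" by auto
  have b: "real (intersection_number G i 1 (i + 1)) = grass_b r Y Q i" if "i \<le> gdiam G" for i
  proof (cases "i = D")
    \<comment> \<open>The classical parameters prescribe b only below D. At D no vertex lies farther
      away, and \<open>grass_b\<close> vanishes since \<open>Y = r ^ D\<close>.\<close>
    case True
    have "gdiam G \<in> range (\<lambda>(y, z). gdist G y z)" unfolding gdiam_def by (rule Max_in) auto
    then obtain y z where yz: "gdist G y z = D" using diam by auto
    have "gdist G z w \<noteq> D + 1" for w using gdist_le_gdiam[of G z w] diam by simp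
    then have "sphere_meet G 1 (D + 1) y z = {}" by (simp add: sphere_meet_def)
    then show ?thesis using card_sphere_meet[OF G, of 1 "D + 1" y z] True yz by (simp add: grass_b_def Y_def)
  next
    case False
    then have "real (intersection_number G i 1 (i + 1)) =
        (qnum r D - qnum r i) * (r\<^sup>2 * (r ^ D - 1) / (r - 1) - r * qnum r i)"
      using cp that diam by (simp add: classical_parameters_def r_def)
    also have "\<dots> = (Y - r ^ i) / (r - 1) * (r * (Q - r ^ i) / (r - 1))"
    proof -
      have "qnum r D - qnum r i = (Y - r ^ i) / (r - 1)"
        using r by (simp add: qnum_eq Y_def diff_divide_distrib[symmetric])
      moreover have "r\<^sup>2 * (r ^ D - 1) / (r - 1) - r * qnum r i = r * (Q - r ^ i) / (r - 1)"
        using r by (simp add: qnum_eq Y_def[symmetric] Q_def diff_divide_distrib[symmetric])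
          (simp add: algebra_simps power2_eq_square)
      ultimately show ?thesis by simp
    qed
    finally show ?thesis by (simp add: grass_b_def power2_eq_square mult_ac)
  qed
  have c: "real (intersection_number G i 1 (i - 1)) = grass_c r i" if "i \<le> gdiam G" for i
  proof (cases i)
    case 0
    have "gdist G y y = 0" for y using gdist_eq_0_iff[OF Gc] by blast
    moreover have "sphere_meet G 1 0 y y = {}" for y by (auto simp: sphere_meet_def)
    ultimately have "intersection_number G 0 1 0 = 0"
      using card_sphere_meet[OF G, of 1 0] by (metis card.empty)
    then show ?thesis using 0 by (simp add: grass_c_def)
  next
    case (Suc k)
    then have "i \<in> {1..D}" using that diam by simp
    then have "real (intersection_number G i 1 (i - 1)) = qnum r i * (1 + r * qnum r (i - 1))"
      using cp unfolding classical_parameters_def r_def by blast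
    then have "real (intersection_number G i 1 (i - 1)) = qnum r i * (1 + r * qnum r k)"
      by (simp add: Suc)
    \<comment> \<open>This is where \<alpha> = q enters: c becomes the square of
      \<open>qnum r i\<close>.\<close>
    also have "1 + r * qnum r k = qnum r i"
      using r by (simp add: qnum_eq Suc field_simps)
    finally show ?thesis using r by (simp add: qnum_eq grass_c_def power2_eq_square)
  qed
  have b_nz: "grass_b r Y Q i \<noteq> 0" if "i < gdiam G" for i
  proof -
    have "r ^ i < Y" unfolding Y_def using that diam r by (intro power_strict_increasing) auto
    then show ?thesis using \<open>Y \<le> Q\<close> r by (simp add: grass_b_def)
  qed
  note int = grass_multiplicities_integral[OF G r YQ b c b_nz]
  define g where "g n = (\<Sum>k<n. q ^ k)" for n
  \<comment> \<open>\<open>N0\<close>, \<open>N1\<close> and \<open>N2\<close> are integer forms of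
    \<open>(Y * Q / q ^ k - 1) / (q - 1)\<close> for k = 0, 1, 2.\<close>
  define N0 where "N0 = g D * (1 + q ^ (D + 1))"
  define N1 where "N1 = g (D - 1) + g D * q ^ D"
  define N2 where "N2 = g (D - 2) + g D * q ^ (D - 1)"
  have step: "g (Suc n) = 1 + q * g n" for n
    by (simp add: g_def sum.lessThan_Suc_shift sum_distrib_left del: sum.lessThan_Suc)
  obtain e where D: "D = Suc (Suc e)" using that[of "D - 2"] assms(1) by simp
  have N: "N0 = 1 + q * N1" "N1 = 1 + q * N2"
    by (simp_all add: N0_def N1_def N2_def D step algebra_simps)
  have S: "Y * Q = 1 + (r - 1) * real_of_int N0"
  proof -
    have "(r - 1) * real_of_int (g D) = Y - 1"
      by (simp add: g_def r_def Y_def power_diff_1_eq)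
    then have "(r - 1) * real_of_int N0 = (Y - 1) * (1 + r * Y)"
      by (simp add: N0_def r_def Y_def mult.assoc[symmetric])
    then show ?thesis by (simp add: Q_def algebra_simps)
  qed
  have rN: "real_of_int N0 = 1 + r * N1" "real_of_int N1 = 1 + r * N2"
    by (simp_all add: N r_def)
  have nz: "r \<noteq> 0" "r - 1 \<noteq> 0" "r + 1 \<noteq> 0" "r\<^sup>2 + r + 1 \<noteq> 0"
    using r zero_le_power2[of r] by linarith+
  have "(Y * Q - 1) * (Y * Q - r ^ 3) / (r * (r - 1) * (r\<^sup>2 - 1)) = real_of_int (N0 * N1) / (r + 1) - N0"
  proof -
    have "Y * Q - 1 = (r - 1) * N0" "Y * Q - r ^ 3 = r * (r - 1) * (N1 - (r + 1))"
      unfolding S rN(1) by (simp_all add: algebra_simps power2_eq_square power3_eq_cube)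
    moreover have "r\<^sup>2 - 1 = (r - 1) * (r + 1)" by (simp add: algebra_simps power2_eq_square)
    moreover have "m * x * (t * m * (y - p)) / (t * m * (m * p)) = x * y / p - x"
      if "t \<noteq> 0" "m \<noteq> 0" "p \<noteq> 0" for t m p x y :: real
      using that by (simp add: field_simps)
    ultimately show ?thesis using nz by simp
  qed
  then have "real_of_int (N0 * N1) / (r + 1) - N0 \<in> \<int>" using int(1) by simp
  then have i2: "real_of_int (N0 * N1) / (r + 1) \<in> \<int>"
    using Ints_add[OF _ Ints_of_int[of N0]] by (metis diff_add_cancel)
  have "(Y * Q - 1) * (Y * Q - r) * (Y * Q - r ^ 5) / (r ^ 3 * (r - 1) * (r\<^sup>2 - 1) * (r ^ 3 - 1))
      = real_of_int (N0 * N1 * N2) / ((r + 1) * (r\<^sup>2 + r + 1)) - real_of_int (N0 * N1) / (r + 1)"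
  proof -
    have "Y * Q - 1 = (r - 1) * N0" by (simp add: S)
    moreover have "Y * Q - r = r * (r - 1) * N1" "Y * Q - r ^ 5 = r\<^sup>2 * (r - 1) * (N2 - (r\<^sup>2 + r + 1))"
      unfolding S rN(1) by (simp_all add: rN(2) algebra_simps eval_nat_numeral)
    moreover have "r\<^sup>2 - 1 = (r - 1) * (r + 1)" "r ^ 3 - 1 = (r - 1) * (r\<^sup>2 + r + 1)"
      by (simp_all add: algebra_simps eval_nat_numeral)
    moreover have "m * x * (t * m * y) * (t\<^sup>2 * m * (z - n)) / (t ^ 3 * m * (m * p) * (m * n)) =
        x * y * z / (p * n) - x * y / p"
      if "t \<noteq> 0" "m \<noteq> 0" "p \<noteq> 0" "n \<noteq> 0" for t m p n x y z :: real
      using that by (simp add: field_simps eval_nat_numeral)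
    ultimately show ?thesis using nz by simp
  qed
  then have "real_of_int (N0 * N1 * N2) / ((r + 1) * (r\<^sup>2 + r + 1)) - real_of_int (N0 * N1) / (r + 1) \<in> \<int>"
    using int(2) by simp
  \<comment> \<open>The subtracted quotient is integral by \<open>i2\<close>.\<close>
  then have i3: "real_of_int (N0 * N1 * N2) / ((r + 1) * (r\<^sup>2 + r + 1)) \<in> \<int>"
    using Ints_add[OF _ i2] by (metis diff_add_cancel)
  have "q + 1 \<noteq> 0" "q\<^sup>2 + q + 1 \<noteq> 0" using assms(2) zero_le_power2[of q] by linarith+
  then have "q + 1 dvd N0 * N1" "(q + 1) * (q\<^sup>2 + q + 1) dvd N0 * N1 * N2"
    using i2 i3 of_int_divide_in_Ints_iff[of "q + 1" "N0 * N1"]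
      of_int_divide_in_Ints_iff[of "(q + 1) * (q\<^sup>2 + q + 1)" "N0 * N1 * N2"]
    by (simp_all add: r_def)
  \<comment> \<open>The powers of q eliminate \<open>N1\<close> and \<open>N2\<close>, because
    \<open>q * N1 = N0 - 1\<close> and \<open>q\<^sup>2 * N2 = N0 - 1 - q\<close>.\<close>
  then have dvd: "q + 1 dvd q * (N0 * N1)" "q\<^sup>2 + q + 1 dvd q ^ 3 * (N0 * N1 * N2)"
    using dvd_mult_right by (blast intro: dvd_mult)+
  have eqs: "q * (N0 * N1) = N0 * (N0 - 1)"
    "q ^ 3 * (N0 * N1 * N2) = N0 * (N0 - 1) * (N0 - 1 - q)"
    by (simp_all add: N algebra_simps eval_nat_numeral)
  have "D mod 6 = 0"
    using dvd unfolding eqs unfolding N0_def g_def by (rule grassmann_divisibility[OF assms(2)])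
  then show False using assms(3) by simp
qed

end
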